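(* Let $\Phi \colon G \to G'$ be a morphism of the discrete constrained Lagrangian systems $(G, N, L)$ and $(G', N', L')$, and suppose $\mu \in T^\ast G$ and $\mu' \in T^\ast G'$ are $\Phi^\ast$-related. Then the following are true: (1) if $\mu' \in \Sigma_{L'}$, then $\mu \in \Sigma_L$; (2) the sources $\widetilde{\alpha}(\mu) \in A^\ast G$ and $\widetilde{\alpha}'(\mu') \in A^\ast G'$ are $A^\ast \Phi$-related; (3) the targets $\widetilde{\beta}(\mu) \in A^\ast G$ and $\widetilde{\beta}'(\mu') \in A^\ast G'$ are $A^\ast \Phi$-related.
   Context: A Lie groupoid $G \rightrightarrows Q$ has submersions $\alpha, \beta \colon G \to Q$ (source, target), a smooth multiplication $gh$ defined for $(g,h) \in G_2 = \{(g,h) : \beta(g) = \alpha(h)\}$, an identity section $\epsilon \colon Q \to G$ and an inversion $i \colon G \to G$, with $\epsilon(\alpha(g)) g = g = g\,\epsilon(\beta(g))$, $g g^{-1} = \epsilon(\alpha(g))$, $g^{-1} g = \epsilon(\beta(g))$. Translations: $\ell_g \colon \alpha^{-1}(\beta(g)) \to \alpha^{-1}(\alpha(g))$, $\ell_g(h) = gh$, and $r_g \colon \beta^{-1}(\alpha(g)) \to \beta^{-1}(\beta(g))$, $r_g(h) = hg$. The Lie algebroid $AG \to Q$ is the vector bundle with fibers $A_q G = \ker T_{\epsilon(q)} \alpha$, and $A^\ast G \to Q$ is the dual bundle. For a section $X \in \Gamma(AG)$, $\overleftarrow{X}(g) = T_{\epsilon(\beta(g))} \ell_g (X(\beta(g)))$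 and $\overrightarrow{X}(g) = - T_{\epsilon(\alpha(g))}(r_g \circ i)(X(\alpha(g)))$. The cotangent groupoid $T^\ast G \rightrightarrows A^\ast G$ has source $\widetilde{\alpha}$ and target $\widetilde{\beta}$ given, for $\mu \in T_g^\ast G$, by $\widetilde{\alpha}(\mu) \in A^\ast_{\alpha(g)} G$, $\widetilde{\beta}(\mu) \in A^\ast_{\beta(g)} G$ with $\langle \widetilde{\alpha}(\mu), X(\alpha(g)) \rangle = \langle \mu, \overrightarrow{X}(g) \rangle$ and $\langle \widetilde{\beta}(\mu), X(\beta(g)) \rangle = \langle \mu, \overleftarrow{X}(g) \rangle$ for all $X \in \Gamma(AG)$. Primes denote the corresponding objects for $G' \rightrightarrows Q'$. A discrete constrained Lagrangian system $(G, N, L)$ consists of a Lie groupoid $G \rightrightarrows Q$, a submanifold $N \subset G$, and a smooth function $L \colon N \to \mathbb{R}$. Its associated Lagrangian submanifold is $$\Sigma_L = \{ p \in T^\ast G : \pi_G(p) \in N \text{ and } \langle p, v \rangle = \langle \mathrm{d}L, v \rangle \text{ for all } v \in T_{\pi_G(p)} N \},$$ where $\pi_G \colon T^\ast G \to G$ is the projection. A smooth map $\Phi \colon G \to G'$ is a morphism of Lie groupoids if for every $(g,h) \in G_2$ one has $(\Phi(g), \Phi(h)) \in G'_2$ and $\Phi(gh) = \Phi(g)\Phi(h)$. It induces a smooth map $\Phi_0 \colon Q \to Q'$ with $\alpha' \circ \Phi = \Phi_0 \circ \alpha$, $\beta' \circ \Phi = \Phi_0 \circ \beta$, $\Phi \circ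 \epsilon = \epsilon' \circ \Phi_0$, and a Lie algebroid morphism $A\Phi \colon AG \to AG'$, the restriction of $T\Phi$ to $AG$. It is a morphism of discrete constrained Lagrangian systems $(G,N,L) \to (G',N',L')$ if in addition $N = \Phi^{-1}(N')$ and $L = L' \circ \Phi$ (on $N$). Covectors $\mu \in T_g^\ast G$ and $\mu' \in T^\ast_{\Phi(g)} G'$ are $\Phi^\ast$-related if $\langle \mu, v \rangle = \langle \mu', T\Phi(v) \rangle$ for all $v \in T_g G$. Elements $p \in A_q^\ast G$ and $p' \in A^\ast_{\Phi_0(q)} G'$ are $A^\ast\Phi$-related if $\langle p, v \rangle = \langle p', A\Phi(v) \rangle$ for all $v \in A_q G$. *)

theory Defs
  imports "HOL-Analysis.Analysis"
begin

section \<open>Smooth maps between Euclidean spaces\<close>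

primrec C_k_on :: "nat \<Rightarrow> 'e::euclidean_space set \<Rightarrow> ('e \<Rightarrow> 'f::real_normed_vector) \<Rightarrow> bool" where
  "C_k_on 0 U f \<longleftrightarrow> continuous_on U f"
| "C_k_on (Suc k) U f \<longleftrightarrow>
     (\<forall>x\<in>U. f differentiable (at x)) \<and>
     (\<forall>v. C_k_on k U (\<lambda>x. frechet_derivative f (at x) v))"

definition smooth_on_open :: "'e::euclidean_space set \<Rightarrow> ('e \<Rightarrow> 'f::real_normed_vector) \<Rightarrow> bool" where
  "smooth_on_open U f \<longleftrightarrow> open U \<and> (\<forall>k. C_k_on k U f)"

text \<open>Smoothness on a neighbourhood of \<open>x\<close> in the subset \<open>E\<close>: local extendability to a smooth map of
  an open subset of the ambient space.\<close>

definition smooth_near :: "'e::euclidean_space set \<Rightarrow> 'e \<Rightarrow> ('e \<Rightarrow> 'f::real_normed_vector) \<Rightarrow> bool" where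
  "smooth_near E x f \<longleftrightarrow> (\<exists>U F. x \<in> U \<and> smooth_on_open U F \<and> (\<forall>y\<in>U \<inter> E. f y = F y))"


section \<open>Smooth manifolds\<close>

text \<open>A manifold is the whole type \<open>'a\<close>, with charts onto relatively open subsets of one linear subspace
  \<open>model M\<close> of the Euclidean space \<open>'e\<close>; the dimension of \<open>M\<close> is \<open>dim (model M)\<close>.  A subspace is
  used, rather than all of \<open>'e\<close>, because the class \<open>euclidean_space\<close> excludes dimension zero (needed
  e.g. for Lie groups, i.e. groupoids over a point).\<close>

type_synonym ('a, 'e) chart = "'a set \<times> ('a \<Rightarrow> 'e)"

record ('a, 'e) manifold =
  model :: "'e set"
  atlas :: "('a, 'e) chart set"

definition chart_inv :: "('a, 'e) chart \<Rightarrow> 'e \<Rightarrow> 'a" where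
  "chart_inv c = inv_into (fst c) (snd c)"

definition is_chart :: "'e set \<Rightarrow> ('a::topological_space, 'e::euclidean_space) chart \<Rightarrow> bool" where
  "is_chart E c \<longleftrightarrow> open (fst c) \<and> openin (top_of_set E) (snd c ` fst c) \<and>
     homeomorphism (fst c) (snd c ` fst c) (snd c) (chart_inv c)"

definition smooth_transition :: "'e set \<Rightarrow> ('a, 'e::euclidean_space) chart \<Rightarrow> ('a, 'e) chart \<Rightarrow> bool" where
  "smooth_transition E c d \<longleftrightarrow> (\<forall>p\<in>fst c \<inter> fst d. smooth_near E (snd c p) (snd d \<circ> chart_inv c))"

definition smooth_manifold ::
    "('a::{t2_space, second_countable_topology}, 'e::euclidean_space) manifold \<Rightarrow> bool" where
  "smooth_manifold M \<longleftrightarrow> subspace (model M) \<and> (\<forall>c\<in>atlas M. is_chart (model M) c) \<and>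
     (\<Union>c\<in>atlas M. fst c) = UNIV \<and> (\<forall>c\<in>atlas M. \<forall>d\<in>atlas M. smooth_transition (model M) c d)"

text \<open>The charts of the maximal atlas.\<close>

definition smooth_chart ::
    "('a::topological_space, 'e::euclidean_space) manifold \<Rightarrow> ('a, 'e) chart \<Rightarrow> bool" where
  "smooth_chart M c \<longleftrightarrow> is_chart (model M) c \<and>
     (\<forall>d\<in>atlas M. smooth_transition (model M) c d \<and> smooth_transition (model M) d c)"

definition real_line :: "(real, real) manifold" where
  "real_line = \<lparr>model = UNIV, atlas = {(UNIV, \<lambda>x. x)}\<rparr>"

definition prod_manifold :: "('a, 'e) manifold \<Rightarrow> ('b, 'f) manifold \<Rightarrow> ('a \<times> 'b, 'e \<times> 'f) manifold" where
  "prod_manifold M M' = \<lparr>model = model M \<times> model M',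
     atlas = {(fst c \<times> fst d, map_prod (snd c) (snd d)) | c d. c \<in> atlas M \<and> d \<in> atlas M'}\<rparr>"

text \<open>Embedded submanifolds of dimension \<open>k\<close>, by slice charts.\<close>

definition submanifold :: "('a::topological_space, 'e::euclidean_space) manifold \<Rightarrow> 'a set \<Rightarrow> bool" where
  "submanifold M N \<longleftrightarrow> (\<exists>k. \<forall>p\<in>N. \<exists>c S. smooth_chart M c \<and> p \<in> fst c \<and>
     subspace S \<and> S \<subseteq> model M \<and> dim S = k \<and> snd c ` (fst c \<inter> N) = snd c ` fst c \<inter> S)"

text \<open>Smoothness on some neighbourhood of \<open>p\<close>.\<close>

definition smooth_map_near ::
    "('a::topological_space, 'e::euclidean_space) manifold \<Rightarrow> ('b, 'f::euclidean_space) manifold \<Rightarrow>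
     ('a \<Rightarrow> 'b) \<Rightarrow> 'a \<Rightarrow> bool" where
  "smooth_map_near M M' f p \<longleftrightarrow> (\<exists>c\<in>atlas M. \<exists>d\<in>atlas M'.
     p \<in> fst c \<and> (\<exists>W. open W \<and> p \<in> W \<and> f ` W \<subseteq> fst d) \<and>
     smooth_near (model M) (snd c p) (snd d \<circ> f \<circ> chart_inv c))"

text \<open>Smoothness of the restriction of \<open>f\<close> to a subset \<open>S\<close>: local extendability to the ambient manifold.
  For an embedded submanifold \<open>S\<close> this is smoothness for the induced manifold structure of \<open>S\<close>; for
  \<open>S = UNIV\<close> it is smoothness on \<open>M\<close>.  Values of \<open>f\<close> outside \<open>S\<close> are irrelevant.\<close>

definition smooth_map_at ::
    "('a::topological_space, 'e::euclidean_space) manifold \<Rightarrow> 'a set \<Rightarrow>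
     ('b, 'f::euclidean_space) manifold \<Rightarrow> ('a \<Rightarrow> 'b) \<Rightarrow> 'a \<Rightarrow> bool" where
  "smooth_map_at M S M' f p \<longleftrightarrow> (\<exists>W F. open W \<and> p \<in> W \<and> smooth_map_near M M' F p \<and> (\<forall>x\<in>W \<inter> S. f x = F x))"

definition smooth_map_on ::
    "('a::topological_space, 'e::euclidean_space) manifold \<Rightarrow> 'a set \<Rightarrow>
     ('b, 'f::euclidean_space) manifold \<Rightarrow> ('a \<Rightarrow> 'b) \<Rightarrow> bool" where
  "smooth_map_on M S M' f \<longleftrightarrow> (\<forall>p\<in>S. smooth_map_at M S M' f p)"


section \<open>Tangent and cotangent vectors\<close>

text \<open>Functions on \<open>S\<close> that are smooth near \<open>p\<close>.\<close>

definition smooth_funs_at ::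
    "('a::topological_space, 'e::euclidean_space) manifold \<Rightarrow> 'a set \<Rightarrow> 'a \<Rightarrow> ('a \<Rightarrow> real) set" where
  "smooth_funs_at M S p = {f. smooth_map_at M S real_line f p}"

text \<open>\<open>T\<^sub>p S\<close>, for a submanifold \<open>S\<close> of \<open>M\<close> (\<open>S = UNIV\<close> gives \<open>T\<^sub>p M\<close>), as the space of derivations at \<open>p\<close>.
  The Leibniz rule, applied with indicator functions of neighbourhoods of \<open>p\<close>, shows that the value of a
  derivation depends only on the germ at \<open>p\<close> of a function on \<open>S\<close>.\<close>

type_synonym 'a tangent_vector = "('a \<Rightarrow> real) \<Rightarrow> real"

definition tangent_space ::
    "('a::topological_space, 'e::euclidean_space) manifold \<Rightarrow> 'a set \<Rightarrow> 'a \<Rightarrow> 'a tangent_vector set" where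
  "tangent_space M S p = {v.
     (\<forall>f\<in>smooth_funs_at M S p. \<forall>g\<in>smooth_funs_at M S p.
        v (\<lambda>x. f x + g x) = v f + v g \<and> v (\<lambda>x. f x * g x) = v f * g p + f p * v g) \<and>
     (\<forall>c. \<forall>f\<in>smooth_funs_at M S p. v (\<lambda>x. c * f x) = c * v f) \<and>
     (\<forall>f. f \<notin> smooth_funs_at M S p \<longrightarrow> v f = 0)}"

text \<open>The tangent map at \<open>p\<close> of \<open>f\<close>, regarded as a map into \<open>M'\<close>.\<close>

definition tangent_map ::
    "('b::topological_space, 'f::euclidean_space) manifold \<Rightarrow> ('a \<Rightarrow> 'b) \<Rightarrow> 'a \<Rightarrow>
     'a tangent_vector \<Rightarrow> 'b tangent_vector" where
  "tangent_map M' f p v = (\<lambda>\<phi>. if \<phi> \<in> smooth_funs_at M' UNIV (f p) then v (\<phi> \<circ> f) else 0)"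

text \<open>The tangent map of the inclusion of a submanifold into \<open>M\<close>, and its inverse on the image.\<close>

definition push_incl ::
    "('a::topological_space, 'e::euclidean_space) manifold \<Rightarrow> 'a \<Rightarrow> 'a tangent_vector \<Rightarrow> 'a tangent_vector" where
  "push_incl M p = tangent_map M (\<lambda>x. x) p"

definition pull_incl ::
    "('a::topological_space, 'e::euclidean_space) manifold \<Rightarrow> 'a set \<Rightarrow> 'a \<Rightarrow>
     'a tangent_vector \<Rightarrow> 'a tangent_vector" where
  "pull_incl M S p v = (THE w. w \<in> tangent_space M S p \<and> push_incl M p w = v)"

definition submersion ::
    "('a::topological_space, 'e::euclidean_space) manifold \<Rightarrow>
     ('b::topological_space, 'f::euclidean_space) manifold \<Rightarrow> ('a \<Rightarrow> 'b) \<Rightarrow> bool" where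
  "submersion M M' f \<longleftrightarrow> smooth_map_on M UNIV M' f \<and>
     (\<forall>p. tangent_map M' f p ` tangent_space M UNIV p = tangent_space M' UNIV (f p))"

definition differential :: "('a \<Rightarrow> real) \<Rightarrow> 'a tangent_vector \<Rightarrow> real" where
  "differential f v = v f"

text \<open>The dual of a linear space \<open>V\<close> of tangent vectors; functionals are extended by zero outside \<open>V\<close>.\<close>

definition dual_space :: "'a tangent_vector set \<Rightarrow> ('a tangent_vector \<Rightarrow> real) set" where
  "dual_space V = {\<mu>.
     (\<forall>v\<in>V. \<forall>w\<in>V. \<mu> (\<lambda>f. v f + w f) = \<mu> v + \<mu> w) \<and>
     (\<forall>c. \<forall>v\<in>V. \<mu> (\<lambda>f. c * v f) = c * \<mu> v) \<and>
     (\<forall>v. v \<notin> V \<longrightarrow> \<mu> v = 0)}"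

text \<open>Elements of \<open>T\<^sup>*M\<close>, and of \<open>A\<^sup>*G\<close> below, are pairs of a base point and a functional.\<close>

definition cotangent_bundle ::
    "('a::topological_space, 'e::euclidean_space) manifold \<Rightarrow> ('a \<times> ('a tangent_vector \<Rightarrow> real)) set" where
  "cotangent_bundle M = (SIGMA p:UNIV. dual_space (tangent_space M UNIV p))"


section \<open>Lie groupoids and their Lie algebroids\<close>

text \<open>\<open>mult G g h\<close> is meaningful only for composable \<open>g\<close>, \<open>h\<close>, i.e. when \<open>tgt G g = src G h\<close>.\<close>

record ('g, 'q, 'e, 'f) groupoid =
  arrows :: "('g, 'e) manifold"
  objects :: "('q, 'f) manifold"
  src :: "'g \<Rightarrow> 'q"
  tgt :: "'g \<Rightarrow> 'q"
  mult :: "'g \<Rightarrow> 'g \<Rightarrow> 'g"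
  ident :: "'q \<Rightarrow> 'g"
  ginv :: "'g \<Rightarrow> 'g"

definition composable :: "('g, 'q, 'e, 'f) groupoid \<Rightarrow> ('g \<times> 'g) set" where
  "composable G = {(g, h). tgt G g = src G h}"

definition groupoid_laws :: "('g, 'q, 'e, 'f) groupoid \<Rightarrow> bool" where
  "groupoid_laws G \<longleftrightarrow>
     (\<forall>(g, h)\<in>composable G. src G (mult G g h) = src G g \<and> tgt G (mult G g h) = tgt G h) \<and>
     (\<forall>g h k. (g, h) \<in> composable G \<and> (h, k) \<in> composable G \<longrightarrow>
        mult G (mult G g h) k = mult G g (mult G h k)) \<and>
     (\<forall>q. src G (ident G q) = q \<and> tgt G (ident G q) = q) \<and>
     (\<forall>g. mult G (ident G (src G g)) g = g \<and> mult G g (ident G (tgt G g)) = g) \<and>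
     (\<forall>g. src G (ginv G g) = tgt G g \<and> tgt G (ginv G g) = src G g) \<and>
     (\<forall>g. mult G g (ginv G g) = ident G (src G g) \<and> mult G (ginv G g) g = ident G (tgt G g))"

definition lie_groupoid ::
    "('g::{t2_space, second_countable_topology}, 'q::{t2_space, second_countable_topology},
      'e::euclidean_space, 'f::euclidean_space) groupoid \<Rightarrow> bool" where
  "lie_groupoid G \<longleftrightarrow> smooth_manifold (arrows G) \<and> smooth_manifold (objects G) \<and> groupoid_laws G \<and>
     submersion (arrows G) (objects G) (src G) \<and> submersion (arrows G) (objects G) (tgt G) \<and>
     smooth_map_on (prod_manifold (arrows G) (arrows G)) (composable G) (arrows G) (\<lambda>(g, h). mult G g h) \<and>
     smooth_map_on (objects G) UNIV (arrows G) (ident G) \<and>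
     smooth_map_on (arrows G) UNIV (arrows G) (ginv G)"

text \<open>\<open>A\<^sub>q G = ker T\<^bsub>\<epsilon>(q)\<^esub> \<alpha>\<close>\<close>

definition algebroid ::
    "('g::topological_space, 'q::topological_space, 'e::euclidean_space, 'f::euclidean_space) groupoid \<Rightarrow>
     'q \<Rightarrow> 'g tangent_vector set" where
  "algebroid G q = {v \<in> tangent_space (arrows G) UNIV (ident G q).
     tangent_map (objects G) (src G) (ident G q) v = (\<lambda>\<phi>. 0)}"

definition dual_algebroid ::
    "('g::topological_space, 'q::topological_space, 'e::euclidean_space, 'f::euclidean_space) groupoid \<Rightarrow>
     ('q \<times> ('g tangent_vector \<Rightarrow> real)) set" where
  "dual_algebroid G = (SIGMA q:UNIV. dual_space (algebroid G q))"

text \<open>\<open>\<Gamma>(AG)\<close>\<close>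

definition algebroid_sections ::
    "('g::topological_space, 'q::topological_space, 'e::euclidean_space, 'f::euclidean_space) groupoid \<Rightarrow>
     ('q \<Rightarrow> 'g tangent_vector) set" where
  "algebroid_sections G = {X. \<forall>q. X q \<in> algebroid G q \<and>
     (\<forall>f\<in>smooth_funs_at (arrows G) UNIV (ident G q). (\<lambda>q'. X q' f) \<in> smooth_funs_at (objects G) UNIV q)}"

text \<open>Tangent maps of \<open>\<ell>\<^sub>g\<close> and \<open>r\<^sub>g \<circ> i\<close> at an identity.  Both maps are defined on an \<open>\<alpha>\<close>-fibre only, so a
  vector in \<open>ker T\<alpha>\<close> is first regarded as a tangent vector of that fibre, via \<open>pull_incl\<close>.\<close>

definition left_translate ::
    "('g::topological_space, 'q, 'e::euclidean_space, 'f) groupoid \<Rightarrow>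
     'g \<Rightarrow> 'g tangent_vector \<Rightarrow> 'g tangent_vector" where
  "left_translate G g v = tangent_map (arrows G) (\<lambda>h. mult G g h) (ident G (tgt G g))
     (pull_incl (arrows G) {h. src G h = tgt G g} (ident G (tgt G g)) v)"

definition right_translate_inv ::
    "('g::topological_space, 'q, 'e::euclidean_space, 'f) groupoid \<Rightarrow>
     'g \<Rightarrow> 'g tangent_vector \<Rightarrow> 'g tangent_vector" where
  "right_translate_inv G g v = tangent_map (arrows G) (\<lambda>h. mult G (ginv G h) g) (ident G (src G g))
     (pull_incl (arrows G) {h. src G h = src G g} (ident G (src G g)) v)"

definition left_field ::
    "('g::topological_space, 'q, 'e::euclidean_space, 'f) groupoid \<Rightarrow>
     ('q \<Rightarrow> 'g tangent_vector) \<Rightarrow> 'g \<Rightarrow> 'g tangent_vector" where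
  "left_field G X g = left_translate G g (X (tgt G g))"

definition right_field ::
    "('g::topological_space, 'q, 'e::euclidean_space, 'f) groupoid \<Rightarrow>
     ('q \<Rightarrow> 'g tangent_vector) \<Rightarrow> 'g \<Rightarrow> 'g tangent_vector" where
  "right_field G X g = (\<lambda>\<phi>. - right_translate_inv G g (X (src G g)) \<phi>)"


section \<open>The cotangent groupoid: source and target\<close>

text \<open>Since \<open>left_field G X g\<close> and \<open>right_field G X g\<close> depend on \<open>X\<close> only through its value at one point, the
  source and target covectors are given here by their values on the vectors of a fibre of \<open>AG\<close>; the
  identities in terms of sections follow as lemmas.\<close>

definition cot_src ::
    "('g::topological_space, 'q::topological_space, 'e::euclidean_space, 'f::euclidean_space) groupoid \<Rightarrow>
     'g \<times> ('g tangent_vector \<Rightarrow> real) \<Rightarrow> 'q \<times> ('g tangent_vector \<Rightarrow> real)" where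
  "cot_src G = (\<lambda>(g, \<mu>). (src G g,
     \<lambda>v. if v \<in> algebroid G (src G g) then \<mu> (\<lambda>\<phi>. - right_translate_inv G g v \<phi>) else 0))"

definition cot_tgt ::
    "('g::topological_space, 'q::topological_space, 'e::euclidean_space, 'f::euclidean_space) groupoid \<Rightarrow>
     'g \<times> ('g tangent_vector \<Rightarrow> real) \<Rightarrow> 'q \<times> ('g tangent_vector \<Rightarrow> real)" where
  "cot_tgt G = (\<lambda>(g, \<mu>). (tgt G g,
     \<lambda>v. if v \<in> algebroid G (tgt G g) then \<mu> (left_translate G g v) else 0))"

lemma cot_src_section:
  "X \<in> algebroid_sections G \<Longrightarrow> snd (cot_src G (g, \<mu>)) (X (src G g)) = \<mu> (right_field G X g)"
  by (simp add: cot_src_def right_field_def algebroid_sections_def)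

lemma cot_tgt_section:
  "X \<in> algebroid_sections G \<Longrightarrow> snd (cot_tgt G (g, \<mu>)) (X (tgt G g)) = \<mu> (left_field G X g)"
  by (simp add: cot_tgt_def left_field_def algebroid_sections_def)


section \<open>Morphisms and related covectors\<close>

definition lie_groupoid_morphism ::
    "('g::topological_space, 'q, 'e::euclidean_space, 'f) groupoid \<Rightarrow>
     ('h::topological_space, 'r, 'k::euclidean_space, 'l) groupoid \<Rightarrow> ('g \<Rightarrow> 'h) \<Rightarrow> bool" where
  "lie_groupoid_morphism G G' \<Phi> \<longleftrightarrow> smooth_map_on (arrows G) UNIV (arrows G') \<Phi> \<and>
     (\<forall>(g, h)\<in>composable G. (\<Phi> g, \<Phi> h) \<in> composable G' \<and> \<Phi> (mult G g h) = mult G' (\<Phi> g) (\<Phi> h))"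

text \<open>The induced map \<open>\<Phi>\<^sub>0\<close>; the formula is forced by \<open>\<alpha>' \<circ> \<Phi> = \<Phi>\<^sub>0 \<circ> \<alpha>\<close> and \<open>\<alpha> \<circ> \<epsilon> = id\<close>.\<close>

definition base_map ::
    "('g, 'q, 'e, 'f) groupoid \<Rightarrow> ('h, 'r, 'k, 'l) groupoid \<Rightarrow> ('g \<Rightarrow> 'h) \<Rightarrow> 'q \<Rightarrow> 'r" where
  "base_map G G' \<Phi> = (\<lambda>q. src G' (\<Phi> (ident G q)))"

definition algebroid_map ::
    "('g, 'q, 'e, 'f) groupoid \<Rightarrow> ('h::topological_space, 'r, 'k::euclidean_space, 'l) groupoid \<Rightarrow>
     ('g \<Rightarrow> 'h) \<Rightarrow> 'q \<Rightarrow> 'g tangent_vector \<Rightarrow> 'h tangent_vector" where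
  "algebroid_map G G' \<Phi> q = tangent_map (arrows G') \<Phi> (ident G q)"

definition cotangent_related ::
    "('a::topological_space, 'e::euclidean_space) manifold \<Rightarrow>
     ('b::topological_space, 'k::euclidean_space) manifold \<Rightarrow> ('a \<Rightarrow> 'b) \<Rightarrow>
     'a \<times> ('a tangent_vector \<Rightarrow> real) \<Rightarrow> 'b \<times> ('b tangent_vector \<Rightarrow> real) \<Rightarrow> bool" where
  "cotangent_related M M' \<Phi> \<mu> \<mu>' \<longleftrightarrow> \<mu> \<in> cotangent_bundle M \<and> \<mu>' \<in> cotangent_bundle M' \<and>
     fst \<mu>' = \<Phi> (fst \<mu>) \<and>
     (\<forall>v\<in>tangent_space M UNIV (fst \<mu>). snd \<mu> v = snd \<mu>' (tangent_map M' \<Phi> (fst \<mu>) v))"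

definition dual_algebroid_related ::
    "('g::topological_space, 'q::topological_space, 'e::euclidean_space, 'f::euclidean_space) groupoid \<Rightarrow>
     ('h::topological_space, 'r::topological_space, 'k::euclidean_space, 'l::euclidean_space) groupoid \<Rightarrow>
     ('g \<Rightarrow> 'h) \<Rightarrow> 'q \<times> ('g tangent_vector \<Rightarrow> real) \<Rightarrow> 'r \<times> ('h tangent_vector \<Rightarrow> real) \<Rightarrow> bool" where
  "dual_algebroid_related G G' \<Phi> p p' \<longleftrightarrow> p \<in> dual_algebroid G \<and> p' \<in> dual_algebroid G' \<and>
     fst p' = base_map G G' \<Phi> (fst p) \<and>
     (\<forall>v\<in>algebroid G (fst p). snd p v = snd p' (algebroid_map G G' \<Phi> (fst p) v))"


section \<open>Discrete constrained Lagrangian systems\<close>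

text \<open>\<open>L\<close> is a function on \<open>N\<close>; its values outside \<open>N\<close> are irrelevant.\<close>

definition discrete_constrained_lagrangian_system ::
    "('g::{t2_space, second_countable_topology}, 'q::{t2_space, second_countable_topology},
      'e::euclidean_space, 'f::euclidean_space) groupoid \<Rightarrow> 'g set \<Rightarrow> ('g \<Rightarrow> real) \<Rightarrow> bool" where
  "discrete_constrained_lagrangian_system G N L \<longleftrightarrow>
     lie_groupoid G \<and> submanifold (arrows G) N \<and> smooth_map_on (arrows G) N real_line L"

definition lagrangian_submanifold ::
    "('g::topological_space, 'q, 'e::euclidean_space, 'f) groupoid \<Rightarrow> 'g set \<Rightarrow> ('g \<Rightarrow> real) \<Rightarrow>
     ('g \<times> ('g tangent_vector \<Rightarrow> real)) set" where
  "lagrangian_submanifold G N L = {(g, p) \<in> cotangent_bundle (arrows G). g \<in> N \<and>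
     (\<forall>v\<in>tangent_space (arrows G) N g. p (push_incl (arrows G) g v) = differential L v)}"

definition dcls_morphism ::
    "('g::topological_space, 'q, 'e::euclidean_space, 'f) groupoid \<Rightarrow> 'g set \<Rightarrow> ('g \<Rightarrow> real) \<Rightarrow>
     ('h::topological_space, 'r, 'k::euclidean_space, 'l) groupoid \<Rightarrow> 'h set \<Rightarrow> ('h \<Rightarrow> real) \<Rightarrow>
     ('g \<Rightarrow> 'h) \<Rightarrow> bool" where
  "dcls_morphism G N L G' N' L' \<Phi> \<longleftrightarrow>
     lie_groupoid_morphism G G' \<Phi> \<and> N = \<Phi> -` N' \<and> (\<forall>g\<in>N. L g = L' (\<Phi> g))"

end

theory Submission
  imports Defs
begin

text \<open>
  Everything follows from naturality of derivatives under \<open>\<Phi>\<close>, once the tangent vectors involved are known to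
  live where they should.

  For the Lagrangian submanifolds this is immediate.  If \<open>v\<close> is tangent to \<open>N\<close> then, as \<open>\<Phi>\<close> maps \<open>N\<close> into
  \<open>N'\<close>, the vector \<open>T\<Phi>(v)\<close> is tangent to \<open>N'\<close>, and
  \<open>\<langle>\<mu>, v\<rangle> = \<langle>\<mu>', T\<Phi>(v)\<rangle> = \<langle>dL', T\<Phi>(v)\<rangle> = \<langle>d(L' \<circ> \<Phi>), v\<rangle> = \<langle>dL, v\<rangle>\<close>
  (lemma \<open>lagrangian_submanifold_related\<close>).

  For sources and targets, the covectors are obtained by pairing \<open>\<mu>\<close> with translates of vectors of the Lie
  algebroid along the map \<open>\<tau> h = g h\<close>, or \<open>\<tau> h = h\<inverse> g\<close>.  A morphism satisfies \<open>\<Phi> \<circ> \<tau> = \<tau>' \<circ> \<Phi>\<close> on the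
  \<open>\<alpha>\<close>-fibre through an identity, so \<open>T\<Phi>\<close> intertwines the two translations (lemma \<open>translate_natural\<close>), and
  the relation between \<open>\<mu>\<close> and \<open>\<mu>'\<close> gives the claim.

  The analytic content lies in making sense of these translates.  The map \<open>\<tau>\<close> exists on an \<open>\<alpha>\<close>-fibre only, so
  a vector of the algebroid, a derivation \<open>v\<close> on the ambient manifold killed by \<open>T\<alpha>\<close>, has to be a derivation
  on the fibre, in one and only one way; only then is translation linear and the source or target an element of
  \<open>A\<^sup>*G\<close>.  Uniqueness is formal (lemma \<open>push_incl_inject\<close>).  Existence amounts to showing that \<open>v\<close>
  annihilates every smooth function vanishing on the fibre (lemma
  \<open>kernel_annihilates_functions_vanishing_on_fibre\<close>).  By Hadamard's lemma, \<open>v\<close> is a directional derivative in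
  coordinates (lemma \<open>tangent_vector_coordinates\<close>), and by the inverse function theorem its direction is the
  velocity of a curve inside the fibre (lemma \<open>curve_in_level_set\<close>), along which such a function is zero.
\<close>

section \<open>Calculus of smooth maps between Euclidean spaces\<close>

lemma C_k_on_subset: "C_k_on k U f \<Longrightarrow> V \<subseteq> U \<Longrightarrow> C_k_on k V f"
  by (induction k arbitrary: f) (auto intro: continuous_on_subset)

lemma C_k_on_cong:
  assumes "open U" "\<And>x. x \<in> U \<Longrightarrow> f x = g x" "C_k_on k U f"
  shows "C_k_on k U g"
  using assms(2,3)
proof (induction k arbitrary: f g)
  case 0
  then show ?case by (simp cong: continuous_on_cong)
next
  case (Suc k)
  have D: "(g has_derivative frechet_derivative f (at x)) (at x)" if "x \<in> U" for x
    using Suc.prems that assms(1)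
    by (auto intro!: has_derivative_transform_within_open[of f _ x UNIV U g] simp: frechet_derivative_works)
  have eq: "frechet_derivative f (at x) v = frechet_derivative g (at x) v" if "x \<in> U" for x v
    using frechet_derivative_at[OF D[OF that]] by simp
  have "C_k_on k U (\<lambda>x. frechet_derivative g (at x) v)" for v
    by (rule Suc.IH[of "\<lambda>x. frechet_derivative f (at x) v"]) (use Suc.prems eq in auto)
  then show ?case using D by (auto simp: differentiable_def)
qed

lemma C_k_on_SucI:
  assumes "open U" "\<And>x. x \<in> U \<Longrightarrow> (f has_derivative f' x) (at x)" "\<And>v. C_k_on k U (\<lambda>x. f' x v)"
  shows "C_k_on (Suc k) U f"
proof -
  have "C_k_on k U (\<lambda>x. frechet_derivative f (at x) v)" for v
    by (rule C_k_on_cong[OF assms(1) _ assms(3)[of v]]) (use frechet_derivative_at assms(2) in metis)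
  then show ?thesis using assms(2) by (auto simp: differentiable_def)
qed

lemma C_k_on_Suc_imp: "C_k_on (Suc k) U f \<Longrightarrow> C_k_on k U f"
proof (induction k arbitrary: f)
  case 0
  then show ?case
    by (auto intro!: continuous_at_imp_continuous_on differentiable_imp_continuous_within)
qed simp

lemma C_k_on_imp_continuous_on: "C_k_on k U f \<Longrightarrow> continuous_on U f"
  by (induction k) (simp, metis C_k_on_Suc_imp)

lemma C_k_on_Suc_derivative:
  "C_k_on (Suc k) U f \<Longrightarrow> x \<in> U \<Longrightarrow> (f has_derivative frechet_derivative f (at x)) (at x)"
  by (simp add: frechet_derivative_works)

lemma C_k_on_const: "open U \<Longrightarrow> C_k_on k U (\<lambda>x. a)"
proof (induction k arbitrary: a)
  case (Suc k)
  then show ?case by (intro C_k_on_SucI[where f' = "\<lambda>x v. 0"]) auto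
qed auto

lemma C_k_on_linear_compose:
  assumes L: "bounded_linear L" and "open U" "C_k_on k U f"
  shows "C_k_on k U (\<lambda>x. L (f x))"
  using assms(3)
proof (induction k arbitrary: f)
  case 0
  then show ?case using bounded_linear.continuous_on[OF L] by auto
next
  case (Suc k)
  show ?case
    by (rule C_k_on_SucI[where f' = "\<lambda>x v. L (frechet_derivative f (at x) v)"])
       (use Suc assms in \<open>auto intro!: bounded_linear.has_derivative[OF L] simp: frechet_derivative_works\<close>)
qed

lemma C_k_on_linear: 
  assumes "bounded_linear L" "open U"
  shows "C_k_on k U L"
proof -
  have "C_k_on k U (\<lambda>x. x)"
  proof (cases k)
    case (Suc m)
    then show ?thesis by (auto intro!: C_k_on_SucI[where f' = "\<lambda>x v. v"] C_k_on_const assms)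
  qed auto
  then show ?thesis using C_k_on_linear_compose[OF assms] by blast
qed

lemma C_k_on_add:
  assumes "open U" "C_k_on k U f" "C_k_on k U g"
  shows "C_k_on k U (\<lambda>x. f x + g x)"
  using assms(2,3)
proof (induction k arbitrary: f g)
  case 0
  then show ?case by (auto intro: continuous_on_add)
next
  case (Suc k)
  show ?case
    by (rule C_k_on_SucI[where f' = "\<lambda>x v. frechet_derivative f (at x) v + frechet_derivative g (at x) v"])
       (use Suc assms in \<open>auto intro!: has_derivative_add simp: frechet_derivative_works\<close>)
qed

lemma C_k_on_sum:
  assumes "open U" "\<And>i. i \<in> I \<Longrightarrow> C_k_on k U (f i)"
  shows "C_k_on k U (\<lambda>x. \<Sum>i\<in>I. f i x)"
  using assms(2)
  by (induction I rule: infinite_finite_induct) (auto intro!: C_k_on_add C_k_on_const assms(1))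

lemma C_k_on_bilinear:
  assumes B: "bounded_bilinear b" and "open U" "C_k_on k U f" "C_k_on k U g"
  shows "C_k_on k U (\<lambda>x. b (f x) (g x))"
  using assms(3,4)
proof (induction k arbitrary: f g)
  case 0
  then show ?case by (auto intro: bounded_bilinear.continuous_on[OF B])
next
  case (Suc k)
  let ?f = "\<lambda>x. frechet_derivative f (at x)" and ?g = "\<lambda>x. frechet_derivative g (at x)"
  show ?case
  proof (rule C_k_on_SucI[OF assms(2), where f' = "\<lambda>x v. b (f x) (?g x v) + b (?f x v) (g x)"])
    show "((\<lambda>x. b (f x) (g x)) has_derivative (\<lambda>v. b (f x) (?g x v) + b (?f x v) (g x))) (at x)"
      if "x \<in> U" for x
      using C_k_on_Suc_derivative[OF Suc.prems(1) that] C_k_on_Suc_derivative[OF Suc.prems(2) that]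
      by (rule bounded_bilinear.FDERIV[OF B])
    show "C_k_on k U (\<lambda>x. b (f x) (?g x v) + b (?f x v) (g x))" for v
      using Suc.prems C_k_on_Suc_imp[OF Suc.prems(1)] C_k_on_Suc_imp[OF Suc.prems(2)]
      by (intro C_k_on_add assms(2) Suc.IH) auto
  qed
qed

text \<open>The derivative of a composite is expanded in a basis because the class of \<open>C\<^sup>k\<close> maps is defined
  through directional derivatives in fixed directions, whereas the chain rule produces the derivative of
  the outer map in a direction that varies with the point.\<close>

lemma frechet_derivative_basis_expansion:
  fixes f :: "'e::euclidean_space \<Rightarrow> 'f::real_normed_vector"
  assumes "(f has_derivative f') (at x)"
  shows "f' v = (\<Sum>b\<in>Basis. (v \<bullet> b) *\<^sub>R f' b)"
proof -
  have l: "linear f'" using assms has_derivative_linear by blast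
  have "f' v = f' (\<Sum>b\<in>Basis. (v \<bullet> b) *\<^sub>R b)" by (simp add: euclidean_representation)
  then show ?thesis by (simp add: linear_sum[OF l] linear_cmul[OF l])
qed

lemma C_k_on_compose:
  fixes f :: "'e::euclidean_space \<Rightarrow> 'f::euclidean_space"
  assumes "open U" "open V" "C_k_on k U f" "C_k_on k V g" "f ` U \<subseteq> V"
  shows "C_k_on k U (\<lambda>x. g (f x))"
  using assms(3,4)
proof (induction k arbitrary: g)
  case 0
  then show ?case using continuous_on_compose2[of V g U f] assms(5) by simp
next
  case (Suc k)
  let ?f = "\<lambda>x. frechet_derivative f (at x)" and ?g = "\<lambda>y. frechet_derivative g (at y)"
  show ?case
  proof (rule C_k_on_SucI[OF assms(1), where f' = "\<lambda>x v. \<Sum>b\<in>Basis. (?f x v \<bullet> b) *\<^sub>R ?g (f x) b"])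
    fix x assume x: "x \<in> U"
    then have f: "(f has_derivative ?f x) (at x)" by (rule C_k_on_Suc_derivative[OF Suc.prems(1)])
    have g: "(g has_derivative ?g (f x)) (at (f x))"
      using C_k_on_Suc_derivative[OF Suc.prems(2)] x assms(5) by blast
    show "((\<lambda>x. g (f x)) has_derivative (\<lambda>v. \<Sum>b\<in>Basis. (?f x v \<bullet> b) *\<^sub>R ?g (f x) b)) (at x)"
      by (rule has_derivative_eq_rhs[OF has_derivative_compose[OF f g]])
         (intro ext frechet_derivative_basis_expansion[OF g])
  next
    fix v
    show "C_k_on k U (\<lambda>x. \<Sum>b\<in>Basis. (?f x v \<bullet> b) *\<^sub>R ?g (f x) b)"
    proof (intro C_k_on_sum C_k_on_bilinear[OF bounded_bilinear_scaleR] assms(1))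
      fix b :: 'f
      show "C_k_on k U (\<lambda>x. ?f x v \<bullet> b)"
        using Suc.prems by (intro C_k_on_linear_compose[OF bounded_linear_inner_left] assms(1)) auto
      show "C_k_on k U (\<lambda>x. ?g (f x) b)"
        using Suc.IH[of "\<lambda>y. ?g y b"] C_k_on_Suc_imp[OF Suc.prems(1)] Suc.prems(2) by simp
    qed
  qed
qed

lemma C_k_on_Pair:
  fixes f :: "'a::euclidean_space \<Rightarrow> 'b::real_normed_vector" and g :: "'a \<Rightarrow> 'c::real_normed_vector"
  assumes "open U" "C_k_on k U f" "C_k_on k U g"
  shows "C_k_on k U (\<lambda>x. (f x, g x))"
proof -
  have "bounded_linear (\<lambda>y::'b. (y, 0::'c))" "bounded_linear (\<lambda>y::'c. (0::'b, y))"
    by (simp_all add: bounded_linear_Pair bounded_linear_ident bounded_linear_zero)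
  then have "C_k_on k U (\<lambda>x. (f x, 0) + (0, g x))"
    using C_k_on_linear_compose[OF _ assms(1,2)] C_k_on_linear_compose[OF _ assms(1,3)]
    by (intro C_k_on_add[OF assms(1)])
  then show ?thesis by simp
qed

lemma continuous_on_blinfun_derivative:
  fixes f :: "'e::euclidean_space \<Rightarrow> 'f::real_normed_vector"
  assumes "C_k_on (Suc k) U f"
  shows "continuous_on U (\<lambda>x. Blinfun (frechet_derivative f (at x)))"
proof (rule continuous_on_blinfun_componentwise)
  fix b :: 'e
  have "continuous_on U (\<lambda>x. frechet_derivative f (at x) b)"
    using assms by (intro C_k_on_imp_continuous_on[of k]) simp
  then show "continuous_on U (\<lambda>x. blinfun_apply (Blinfun (frechet_derivative f (at x))) b)"
    by (rule continuous_on_eq)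
       (simp add: bounded_linear_Blinfun_apply[OF has_derivative_bounded_linear[OF C_k_on_Suc_derivative[OF assms]]])
qed

lemma segment_in_ball:
  fixes p x :: "'e::real_normed_vector"
  assumes "x \<in> ball p r" "t \<in> {0..1}"
  shows "p + t *\<^sub>R (x - p) \<in> ball p r"
proof -
  have "norm (t *\<^sub>R (x - p)) = t * norm (x - p)" using assms(2) by simp
  also have "\<dots> \<le> norm (x - p)" using assms(2) by (intro mult_left_le_one_le) auto
  also have "\<dots> < r" using assms(1) by (simp add: dist_norm norm_minus_commute)
  finally have "norm (t *\<^sub>R (x - p)) < r" .
  then show ?thesis unfolding mem_ball dist_norm by simp
qed

text \<open>Differentiation under the integral sign multiplies the integrand by another power of \<open>t\<close>.  The weight
  \<open>t ^ j\<close> makes the class of these integrals closed under differentiation, so that their smoothness follows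
  by induction on the order.\<close>

lemma ray_integral_has_derivative:
  fixes h :: "'e::euclidean_space \<Rightarrow> real"
  assumes h: "C_k_on (Suc k) (ball p r) h" and x: "x \<in> ball p r"
  shows "((\<lambda>x. integral {0..1} (\<lambda>t. t ^ j * h (p + t *\<^sub>R (x - p)))) has_derivative
     (\<lambda>v. integral {0..1} (\<lambda>t. t ^ Suc j * frechet_derivative h (at (p + t *\<^sub>R (x - p))) v))) (at x)"
proof -
  let ?D = "\<lambda>y. Blinfun (frechet_derivative h (at y))"
  let ?s = "\<lambda>x t. p + t *\<^sub>R (x - p)"
  have s: "?s x t \<in> ball p r" if "x \<in> ball p r" "t \<in> {0..1}" for x t
    using segment_in_ball that by blast
  have D: "(h has_derivative ?D y) (at y)" and D': "blinfun_apply (?D y) = frechet_derivative h (at y)"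
    if "y \<in> ball p r" for y
  proof -
    have "(h has_derivative frechet_derivative h (at y)) (at y)"
      using C_k_on_Suc_derivative[OF h that] .
    moreover from this show "blinfun_apply (?D y) = frechet_derivative h (at y)"
      by (simp add: bounded_linear_Blinfun_apply has_derivative_bounded_linear)
    ultimately show "(h has_derivative ?D y) (at y)" by simp
  qed
  have cs: "continuous_on (ball p r \<times> {0..1}) (\<lambda>(x, t). ?s x t)"
    by (auto intro!: continuous_intros simp: case_prod_unfold)
  have cD: "continuous_on (ball p r \<times> {0..1}) (\<lambda>(x, t). t ^ Suc j *\<^sub>R ?D (?s x t))"
  proof -
    have "continuous_on (ball p r \<times> {0..1}) (\<lambda>z. ?D ((\<lambda>(x, t). ?s x t) z))"
      by (rule continuous_on_compose2[OF continuous_on_blinfun_derivative[OF h] cs]) (use s in auto)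
    then show ?thesis by (auto intro!: continuous_intros simp: case_prod_unfold)
  qed
  have "((\<lambda>x. integral (cbox 0 1) (\<lambda>t. t ^ j * h (?s x t))) has_derivative
     blinfun_apply (integral (cbox 0 1) (\<lambda>t. t ^ Suc j *\<^sub>R ?D (?s x t)))) (at x within ball p r)"
  proof (rule leibniz_rule)
    fix x t assume xt: "x \<in> ball p r" "t \<in> cbox (0::real) 1"
    then have "(h has_derivative ?D (?s x t)) (at (?s x t))" using D s by auto
    then have "((\<lambda>x. h (?s x t)) has_derivative (\<lambda>v. ?D (?s x t) (t *\<^sub>R v))) (at x within ball p r)"
      by (rule has_derivative_compose[rotated]) (auto intro!: derivative_eq_intros)
    then have "((\<lambda>x. t ^ j * h (?s x t)) has_derivative (\<lambda>v. t ^ j * ?D (?s x t) (t *\<^sub>R v))) (at x within ball p r)"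
      by (rule has_derivative_mult_right)
    then show "((\<lambda>x. t ^ j * h (?s x t)) has_derivative blinfun_apply (t ^ Suc j *\<^sub>R ?D (?s x t))) (at x within ball p r)"
      by (rule has_derivative_eq_rhs) (simp add: fun_eq_iff blinfun.scaleR_left blinfun.scaleR_right)
  next
    fix x assume "x \<in> ball p r"
    then have "continuous_on {0..1} (\<lambda>t. h (?s x t))"
      using s by (intro continuous_on_compose2[OF C_k_on_imp_continuous_on[OF h]] continuous_intros) auto
    then show "(\<lambda>t. t ^ j * h (?s x t)) integrable_on cbox 0 1"
      by (intro integrable_continuous continuous_intros) auto
  qed (use x cD in auto)
  moreover have "blinfun_apply (integral (cbox 0 1) (\<lambda>t. t ^ Suc j *\<^sub>R ?D (?s x t))) v
      = integral {0..1} (\<lambda>t. t ^ Suc j * frechet_derivative h (at (?s x t)) v)" for v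
  proof -
    have "continuous_on {0..1} (\<lambda>t. t ^ Suc j *\<^sub>R ?D (?s x t))"
      using continuous_on_compose2[OF cD, of "{0..1}" "\<lambda>t. (x, t)"] x
      by (simp add: continuous_on_Pair image_subset_iff)
    then have "(\<lambda>t. t ^ Suc j *\<^sub>R ?D (?s x t)) integrable_on {0..1}"
      by (rule integrable_continuous_real)
    then have "blinfun_apply (integral {0..1} (\<lambda>t. t ^ Suc j *\<^sub>R ?D (?s x t))) v
       = integral {0..1} (\<lambda>t. blinfun_apply (t ^ Suc j *\<^sub>R ?D (?s x t)) v)"
      by (rule blinfun_apply_integral)
    also have "\<dots> = integral {0..1} (\<lambda>t. t ^ Suc j * frechet_derivative h (at (?s x t)) v)"
      by (rule integral_cong) (use D' s x in \<open>simp add: blinfun.scaleR_left\<close>)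
    finally show ?thesis by simp
  qed
  ultimately have "((\<lambda>x. integral (cbox 0 1) (\<lambda>t. t ^ j * h (?s x t))) has_derivative
     (\<lambda>v. integral {0..1} (\<lambda>t. t ^ Suc j * frechet_derivative h (at (?s x t)) v))) (at x within ball p r)"
    by (rule has_derivative_eq_rhs[OF _ ext])
  then show ?thesis using x by (simp add: at_within_open[OF _ open_ball])
qed

lemma C_k_on_ray_integral:
  fixes h :: "'e::euclidean_space \<Rightarrow> real"
  assumes "C_k_on k (ball p r) h"
  shows "C_k_on k (ball p r) (\<lambda>x. integral {0..1} (\<lambda>t. t ^ j * h (p + t *\<^sub>R (x - p))))"
  using assms
proof (induction k arbitrary: h j)
  case 0
  have s: "p + t *\<^sub>R (x - p) \<in> ball p r" if "x \<in> ball p r" "t \<in> {0..1}" for x t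
    using segment_in_ball that by blast
  have "continuous_on (ball p r \<times> {0..1}) (\<lambda>z. h (p + snd z *\<^sub>R (fst z - p)))"
    by (rule continuous_on_compose2[of "ball p r" h])
      (use 0 s in \<open>auto intro!: continuous_intros simp: case_prod_unfold\<close>)
  then have "continuous_on (ball p r \<times> {0..1}) (\<lambda>(x, t). t ^ j * h (p + t *\<^sub>R (x - p)))"
    by (auto intro!: continuous_intros simp: case_prod_unfold)
  then show ?case using 
      integral_continuous_on_param[of "ball p r" 0 1 "\<lambda>x t. t ^ j * h (p + t *\<^sub>R (x - p))"]
    by (simp add: box_real)
next
  case (Suc k)
  have "C_k_on k (ball p r) (\<lambda>x. frechet_derivative h (at x) v)" for v
    using Suc.prems by simp
  then show ?case
    by (intro C_k_on_SucI[OF open_ball ray_integral_has_derivative[OF Suc.prems]] Suc.IH)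
qed

text \<open>The fundamental theorem of calculus along the rays from \<open>p\<close>: the factor \<open>g b\<close> is the average over the ray
  of the partial derivative in direction \<open>b\<close>.  This is what makes a derivation a directional derivative.\<close>

lemma hadamard:
  fixes f :: "'e::euclidean_space \<Rightarrow> real"
  assumes "smooth_on_open U f" "p \<in> U"
  obtains r g where "r > 0" "ball p r \<subseteq> U" "\<And>b. smooth_on_open (ball p r) (g b)"
    "\<And>b. g b p = frechet_derivative f (at p) b"
    "\<And>x. x \<in> ball p r \<Longrightarrow> f x = f p + (\<Sum>b\<in>Basis. ((x - p) \<bullet> b) * g b x)"
proof -
  obtain r where r: "r > 0" "ball p r \<subseteq> U"
    using assms by (auto simp: smooth_on_open_def open_contains_ball)
  let ?D = "\<lambda>y. frechet_derivative f (at y)"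
  let ?s = "\<lambda>x t. p + t *\<^sub>R (x - p)"
  define g where "g b x = integral {0..1} (\<lambda>t. ?D (?s x t) b)" for b x
  have f: "C_k_on k (ball p r) f" for k
    using assms r C_k_on_subset[of k U f] by (auto simp: smooth_on_open_def)
  then have Db: "C_k_on k (ball p r) (\<lambda>y. ?D y b)" for k b
    using C_k_on.simps(2) by blast
  have "smooth_on_open (ball p r) (g b)" for b
    using C_k_on_ray_integral[OF Db, of _ 0] by (auto simp: smooth_on_open_def g_def[abs_def])
  moreover have "g b p = frechet_derivative f (at p) b" for b
    by (simp add: g_def)
  moreover have "f x = f p + (\<Sum>b\<in>Basis. ((x - p) \<bullet> b) * g b x)" if x: "x \<in> ball p r" for x
  proof -
    have s: "?s x t \<in> ball p r" if "t \<in> {0..1}" for t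
    using segment_in_ball that x by blast
    have D: "(f has_derivative ?D (?s x t)) (at (?s x t))" if "t \<in> {0..1}" for t
      using C_k_on_Suc_derivative[OF f s[OF that]] .
    have "((\<lambda>t. f (?s x t)) has_vector_derivative (\<Sum>b\<in>Basis. ((x - p) \<bullet> b) * ?D (?s x t) b))
        (at t within {0..1})" if "t \<in> {0..1}" for t
    proof -
      have "((\<lambda>t. f (?s x t)) has_derivative (\<lambda>a. ?D (?s x t) (a *\<^sub>R (x - p)))) (at t within {0..1})"
        by (rule has_derivative_compose[where f = "?s x" and g = f, OF _ D[OF that]])
           (auto intro!: derivative_eq_intros)
      moreover have "?D (?s x t) (a *\<^sub>R (x - p)) = a * (\<Sum>b\<in>Basis. ((x - p) \<bullet> b) * ?D (?s x t) b)" for a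
        using frechet_derivative_basis_expansion[OF D[OF that], of "x - p"]
          linear_cmul[OF has_derivative_linear[OF D[OF that]]] by simp
      ultimately show ?thesis by (simp add: has_vector_derivative_def)
    qed
    then have ftc: "((\<lambda>t. \<Sum>b\<in>Basis. ((x - p) \<bullet> b) * ?D (?s x t) b) has_integral (f (?s x 1) - f (?s x 0))) {0..1}"
      by (rule fundamental_theorem_of_calculus[OF zero_le_one])
    have "(\<lambda>t. ?D (?s x t) b) integrable_on {0..1}" for b
      by (rule integrable_continuous_real,
          rule continuous_on_compose2[OF C_k_on_imp_continuous_on[OF Db[of 0 b]], where f = "?s x"])
         (use s in \<open>auto intro!: continuous_intros\<close>)
    then have "((\<lambda>t. \<Sum>b\<in>Basis. ((x - p) \<bullet> b) * ?D (?s x t) b) has_integral (\<Sum>b\<in>Basis. ((x - p) \<bullet> b) * g b x)) {0..1}"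
      unfolding g_def
      by (intro has_integral_sum[OF finite_Basis] has_integral_mult_right integrable_integral)
    from has_integral_unique[OF ftc this] show ?thesis by simp
  qed
  ultimately show ?thesis using that r by blast
qed

section \<open>Smooth maps between manifolds in local coordinates\<close>

text \<open>The properties of a chart that survive in a product of charts without any reference to a model subspace.
  The last conjunct is continuity of the inverse, stated pointwise: points whose coordinates are close
  are close.\<close>

definition coordinate_embedding :: "('a::topological_space, 'e::euclidean_space) chart \<Rightarrow> bool" where
  "coordinate_embedding c \<longleftrightarrow> open (fst c) \<and> continuous_on (fst c) (snd c) \<and> inj_on (snd c) (fst c) \<and>
     (\<forall>W. \<forall>y\<in>W \<inter> fst c. open W \<longrightarrow>
        (\<exists>V. open V \<and> snd c y \<in> V \<and> (\<forall>x\<in>fst c. snd c x \<in> V \<longrightarrow> x \<in> W)))"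

text \<open>Smoothness in two given charts, expressed without inverses of charts: near \<open>p\<close> the coordinates of the
  value are a smooth function, on an open subset of the ambient Euclidean space, of the coordinates of the
  argument.  Composition is then composition of these functions.\<close>

definition smooth_via ::
    "('a::topological_space, 'e::euclidean_space) chart \<Rightarrow> ('b, 'f::euclidean_space) chart \<Rightarrow>
     ('a \<Rightarrow> 'b) \<Rightarrow> 'a \<Rightarrow> bool" where
  "smooth_via c d f p \<longleftrightarrow> (\<exists>W U F. open W \<and> p \<in> W \<and> W \<subseteq> fst c \<and> f ` W \<subseteq> fst d \<and>
     smooth_on_open U F \<and> (\<forall>x\<in>W. snd c x \<in> U \<and> snd d (f x) = F (snd c x)))"

lemma chart_inv_left: "inj_on (snd c) (fst c) \<Longrightarrow> x \<in> fst c \<Longrightarrow> chart_inv c (snd c x) = x"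
  by (simp add: chart_inv_def inv_into_f_f)

lemma is_chart_image_nbhd:
  assumes c: "is_chart E c" and W: "open W" "p \<in> W" "W \<subseteq> fst c"
  obtains V where "open V" "snd c p \<in> V" "V \<inter> E \<subseteq> snd c ` W"
proof -
  have "openin (top_of_set (snd c ` fst c)) (snd c ` W)"
  proof (rule homeomorphism_imp_open_map)
    show "homeomorphism (fst c) (snd c ` fst c) (snd c) (chart_inv c)"
      using c by (simp add: is_chart_def)
    show "openin (top_of_set (fst c)) W"
      using W by (simp add: open_subset)
  qed
  then have "openin (top_of_set E) (snd c ` W)"
    using c openin_trans by (auto simp: is_chart_def)
  then obtain V where "open V" "snd c ` W = E \<inter> V" by (auto simp: openin_open)
  then show ?thesis using that[of V] W by auto
qed

lemma is_chart_inj: "is_chart E c \<Longrightarrow> inj_on (snd c) (fst c)"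
  by (auto simp: is_chart_def homeomorphism_def intro: inj_on_inverseI)

lemma is_chart_model: "is_chart E c \<Longrightarrow> x \<in> fst c \<Longrightarrow> snd c x \<in> E"
  by (auto simp: is_chart_def dest!: openin_imp_subset)

lemma is_chart_coordinate_embedding:
  assumes "is_chart E c"
  shows "coordinate_embedding c"
proof -
  have "\<exists>V. open V \<and> snd c y \<in> V \<and> (\<forall>x\<in>fst c. snd c x \<in> V \<longrightarrow> x \<in> W)"
    if W: "open W" "y \<in> W" "y \<in> fst c" for W y
  proof -
    have "open (W \<inter> fst c)" using W assms by (auto simp: is_chart_def)
    then obtain V where V: "open V" "snd c y \<in> V" "V \<inter> E \<subseteq> snd c ` (W \<inter> fst c)"
      using is_chart_image_nbhd[OF assms, of "W \<inter> fst c" y] W by auto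
    have "x \<in> W" if "x \<in> fst c" "snd c x \<in> V" for x
      using V(3) that is_chart_model[OF assms] inj_onD[OF is_chart_inj[OF assms]] by fastforce
    then show ?thesis using V by blast
  qed
  then show ?thesis
    using assms is_chart_inj[OF assms]
    by (auto simp: coordinate_embedding_def is_chart_def homeomorphism_def)
qed

lemma coordinate_embedding_inverse:
  assumes "coordinate_embedding c" "open W" "y \<in> W" "y \<in> fst c"
  shows "\<exists>V. open V \<and> snd c y \<in> V \<and> (\<forall>x\<in>fst c. snd c x \<in> V \<longrightarrow> x \<in> W)"
  using assms by (simp add: coordinate_embedding_def)

lemma coordinate_embedding_product:
  assumes "coordinate_embedding c" "coordinate_embedding d"
  shows "coordinate_embedding (fst c \<times> fst d, map_prod (snd c) (snd d))"
proof -
  have "\<exists>V. open V \<and> (snd c y, snd d z) \<in> V \<and>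
      (\<forall>x\<in>fst c \<times> fst d. map_prod (snd c) (snd d) x \<in> V \<longrightarrow> x \<in> W)"
    if W: "open W" "(y, z) \<in> W" "y \<in> fst c" "z \<in> fst d" for W y z
  proof -
    obtain A B where AB: "open A" "open B" "(y, z) \<in> A \<times> B" "A \<times> B \<subseteq> W"
      using open_prod_elim[OF W(1,2)] by blast
    obtain V1 where V1: "open V1" "snd c y \<in> V1" "\<forall>x\<in>fst c. snd c x \<in> V1 \<longrightarrow> x \<in> A"
      using coordinate_embedding_inverse[OF assms(1) AB(1)] AB(3) W(3) by blast
    obtain V2 where V2: "open V2" "snd d z \<in> V2" "\<forall>x\<in>fst d. snd d x \<in> V2 \<longrightarrow> x \<in> B"
      using coordinate_embedding_inverse[OF assms(2) AB(2)] AB(3) W(4) by blast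
    show ?thesis
      using V1 V2 AB(4) by (intro exI[of _ "V1 \<times> V2"]) (auto intro: open_Times)
  qed
  moreover have "continuous_on (fst c \<times> fst d) (map_prod (snd c) (snd d))"
  proof -
    have "continuous_on (fst c) (snd c)" "continuous_on (fst d) (snd d)"
      using assms by (simp_all add: coordinate_embedding_def)
    then have "continuous_on (fst c \<times> fst d) (\<lambda>z. (snd c (fst z), snd d (snd z)))"
      by (auto intro!: continuous_on_Pair continuous_on_compose2[where f = fst and g = "snd c"]
          continuous_on_compose2[where f = snd and g = "snd d"] continuous_on_fst continuous_on_snd continuous_on_id)
    then show ?thesis by (simp add: map_prod_def case_prod_unfold)
  qed
  moreover have "open (fst c \<times> fst d)" "inj_on (map_prod (snd c) (snd d)) (fst c \<times> fst d)"
    using assms by (auto simp: coordinate_embedding_def open_Times map_prod_inj_on)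
  ultimately show ?thesis
    unfolding coordinate_embedding_def by (simp add: Ball_def)
qed

lemma smooth_via_cong:
  assumes "smooth_via c d f p" "open W" "p \<in> W" "\<And>x. x \<in> W \<Longrightarrow> g x = f x"
  shows "smooth_via c d g p"
proof -
  obtain V U F where "open V \<and> p \<in> V \<and> V \<subseteq> fst c \<and> f ` V \<subseteq> fst d \<and>
     smooth_on_open U F \<and> (\<forall>x\<in>V. snd c x \<in> U \<and> snd d (f x) = F (snd c x))"
    using assms(1) unfolding smooth_via_def by blast
  then show ?thesis unfolding smooth_via_def
    using assms(2-) by (intro exI[of _ "V \<inter> W"] exI[of _ U] exI[of _ F]) auto
qed

lemma coordinate_preimage_open:
  assumes "coordinate_embedding c" "open W" "W \<subseteq> fst c" "open U" "\<And>x. x \<in> W \<Longrightarrow> snd c x \<in> U"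
    "continuous_on U F" "open V"
  shows "open {x \<in> W. F (snd c x) \<in> V}"
proof -
  have "continuous_on W (\<lambda>x. F (snd c x))"
    by (rule continuous_on_compose2[OF assms(6)])
      (use assms in \<open>auto simp: coordinate_embedding_def intro: continuous_on_subset\<close>)
  then have "open ((\<lambda>x. F (snd c x)) -` V \<inter> W)"
    using continuous_on_open_vimage assms by blast
  then show ?thesis by (simp add: vimage_def Int_def conj_commute)
qed

lemma smooth_on_open_continuous: "smooth_on_open U F \<Longrightarrow> continuous_on U F"
  unfolding smooth_on_open_def using C_k_on_imp_continuous_on by blast

text \<open>Continuity at \<open>p\<close>: the coordinates of the values vary continuously, and continuity of the inverse of the
  target chart carries this over to the values themselves.\<close>

lemma smooth_via_nbhd:
  assumes "coordinate_embedding c" "coordinate_embedding d" "smooth_via c d f p" "open V" "f p \<in> V"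
  obtains W where "open W" "p \<in> W" "f ` W \<subseteq> V"
proof -
  obtain W U F where W: "open W" "p \<in> W" "W \<subseteq> fst c" "f ` W \<subseteq> fst d"
     "smooth_on_open U F" "\<forall>x\<in>W. snd c x \<in> U \<and> snd d (f x) = F (snd c x)"
    using assms(3) unfolding smooth_via_def by blast
  have "f p \<in> V \<inter> fst d" using W assms by auto
  then obtain O' where O': "open O'" "snd d (f p) \<in> O'" "\<forall>x\<in>fst d. snd d x \<in> O' \<longrightarrow> x \<in> V"
    using coordinate_embedding_inverse[OF assms(2,4)] by blast
  have "open {x \<in> W. F (snd c x) \<in> O'}"
    by (rule coordinate_preimage_open[OF assms(1) W(1,3)])
      (use W O' smooth_on_open_continuous[OF W(5)] in \<open>auto simp: smooth_on_open_def\<close>)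
  then show ?thesis
    by (rule that) (use W O' in auto)
qed

lemma smooth_on_open_compose:
  fixes F :: "'e::euclidean_space \<Rightarrow> 'f::euclidean_space"
  assumes "smooth_on_open U F" "smooth_on_open V H"
  shows "smooth_on_open {x \<in> U. F x \<in> V} (\<lambda>x. H (F x))"
proof -
  have "open (F -` V \<inter> U)"
    using continuous_on_open_vimage[of U F] smooth_on_open_continuous[OF assms(1)] assms
    by (auto simp: smooth_on_open_def)
  then have o: "open {x \<in> U. F x \<in> V}" by (simp add: vimage_def Int_def conj_commute)
  have "C_k_on k {x \<in> U. F x \<in> V} (\<lambda>x. H (F x))" for k
    by (rule C_k_on_compose[OF o, of V])
       (use assms in \<open>auto simp: smooth_on_open_def intro: C_k_on_subset[of _ U]\<close>)
  with o show ?thesis by (simp add: smooth_on_open_def)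
qed

lemma smooth_via_compose:
  assumes "coordinate_embedding c" "coordinate_embedding d" "smooth_via c d f p" "smooth_via d e g (f p)"
  shows "smooth_via c e (\<lambda>x. g (f x)) p"
proof -
  obtain W U F where W: "open W" "p \<in> W" "W \<subseteq> fst c" "f ` W \<subseteq> fst d"
     "smooth_on_open U F" "\<forall>x\<in>W. snd c x \<in> U \<and> snd d (f x) = F (snd c x)"
    using assms(3) unfolding smooth_via_def by blast
  obtain V U' H where V: "open V" "f p \<in> V" "V \<subseteq> fst d" "g ` V \<subseteq> fst e"
     "smooth_on_open U' H" "\<forall>x\<in>V. snd d x \<in> U' \<and> snd e (g x) = H (snd d x)"
    using assms(4) unfolding smooth_via_def by blast
  obtain W' where W': "open W'" "p \<in> W'" "f ` W' \<subseteq> V"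
    using smooth_via_nbhd[OF assms(1-3) V(1,2)] .
  show ?thesis unfolding smooth_via_def
  proof (intro exI conjI)
    show "open (W \<inter> W')" using W W' by auto
    show "smooth_on_open {x \<in> U. F x \<in> U'} (\<lambda>x. H (F x))"
      by (rule smooth_on_open_compose[OF W(5) V(5)])
    show "\<forall>x\<in>W \<inter> W'. snd c x \<in> {x \<in> U. F x \<in> U'} \<and> snd e (g (f x)) = H (F (snd c x))"
    proof
      fix x assume x: "x \<in> W \<inter> W'"
      then have "f x \<in> V" "snd c x \<in> U" "snd d (f x) = F (snd c x)" using W(6) W'(3) by auto
      moreover from this have "snd d (f x) \<in> U'" "snd e (g (f x)) = H (snd d (f x))" using V(6) by auto
      ultimately show "snd c x \<in> {x \<in> U. F x \<in> U'} \<and> snd e (g (f x)) = H (F (snd c x))" by simp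
    qed
  qed (use W(2,3) W'(2,3) V(4) in \<open>auto simp: image_subset_iff subset_iff\<close>)
qed

lemma smooth_near_imp_smooth_via:
  assumes "coordinate_embedding c" "p \<in> fst c" "open W" "p \<in> W" "f ` W \<subseteq> fst d"
    "smooth_near E (snd c p) (snd d \<circ> f \<circ> chart_inv c)" "\<And>x. x \<in> fst c \<Longrightarrow> snd c x \<in> E"
  shows "smooth_via c d f p"
proof -
  obtain U F where U: "snd c p \<in> U" "smooth_on_open U F" 
      "\<forall>y\<in>U \<inter> E. (snd d \<circ> f \<circ> chart_inv c) y = F y"
    using assms(6) unfolding smooth_near_def by blast
  have inj: "inj_on (snd c) (fst c)" and oc: "open (fst c)" and cc: "continuous_on (fst c) (snd c)"
    using assms(1) by (auto simp: coordinate_embedding_def)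
  have "open (snd c -` U \<inter> fst c)"
    using continuous_on_open_vimage[OF oc, of "snd c"] cc U by (auto simp: smooth_on_open_def)
  then have "open (W \<inter> (snd c -` U \<inter> fst c))" using assms(3) by blast
  moreover have "snd d (f x) = F (snd c x)" if "x \<in> W \<inter> (snd c -` U \<inter> fst c)" for x
  proof -
    have "snd c x \<in> U \<inter> E" using that assms(7) by auto
    then have "(snd d \<circ> f \<circ> chart_inv c) (snd c x) = F (snd c x)" using U(3) by blast
    then show ?thesis using chart_inv_left[OF inj] that by simp
  qed
  ultimately show ?thesis
    unfolding smooth_via_def
    using U(1,2) assms(2,4,5)
    by (intro exI[of _ "W \<inter> (snd c -` U \<inter> fst c)"] exI[of _ U] exI[of _ F]) blast
qed

lemma smooth_via_imp_smooth_near: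
  assumes "is_chart E c" "smooth_via c d f p"
  shows "smooth_near E (snd c p) (snd d \<circ> f \<circ> chart_inv c)"
proof -
  obtain W U F where W: "open W" "p \<in> W" "W \<subseteq> fst c" "f ` W \<subseteq> fst d"
     "smooth_on_open U F" "\<forall>x\<in>W. snd c x \<in> U \<and> snd d (f x) = F (snd c x)"
    using assms(2) unfolding smooth_via_def by blast
  obtain V where V: "open V" "snd c p \<in> V" "V \<inter> E \<subseteq> snd c ` W"
    using is_chart_image_nbhd[OF assms(1) W(1-3)] .
  have "smooth_on_open (U \<inter> V) F"
    using W(5) V(1) by (auto simp: smooth_on_open_def intro: C_k_on_subset)
  moreover have "(snd d \<circ> f \<circ> chart_inv c) y = F y" if "y \<in> U \<inter> V \<inter> E" for y
  proof -
    have "y \<in> snd c ` W" using V(3) that by auto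
    then obtain x where "x \<in> W" "y = snd c x" by auto
    then show ?thesis using W chart_inv_left[OF is_chart_inj[OF assms(1)]] by auto
  qed
  ultimately show ?thesis
    unfolding smooth_near_def using W V by (intro exI[of _ "U \<inter> V"] exI[of _ F]) auto
qed

lemma smooth_manifold_chart: "smooth_manifold M \<Longrightarrow> c \<in> atlas M \<Longrightarrow> is_chart (model M) c"
  by (simp add: smooth_manifold_def)

lemma smooth_manifold_coordinate_embedding:
  "smooth_manifold M \<Longrightarrow> c \<in> atlas M \<Longrightarrow> coordinate_embedding c"
  using is_chart_coordinate_embedding smooth_manifold_chart by blast

lemma smooth_manifold_chart_at:
  assumes "smooth_manifold M"
  obtains c where "c \<in> atlas M" "p \<in> fst c"
proof -
  have "p \<in> (\<Union>c\<in>atlas M. fst c)" using assms by (simp add: smooth_manifold_def)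
  then show ?thesis using that by blast
qed

lemma smooth_map_near_imp_smooth_via:
  assumes "\<And>c. c \<in> atlas M \<Longrightarrow> coordinate_embedding c" "\<And>c x. c \<in> atlas M \<Longrightarrow> x \<in> fst c \<Longrightarrow> snd c x \<in> model M"
    "smooth_map_near M M' f p"
  obtains c d where "c \<in> atlas M" "d \<in> atlas M'" "smooth_via c d f p"
proof -
  obtain c d W where "c \<in> atlas M" "d \<in> atlas M'" "p \<in> fst c" "open W" "p \<in> W" "f ` W \<subseteq> fst d"
     "smooth_near (model M) (snd c p) (snd d \<circ> f \<circ> chart_inv c)"
    using assms(3) by (auto simp: smooth_map_near_def)
  note W = this
  have "smooth_via c d f p"
    by (rule smooth_near_imp_smooth_via[OF assms(1)[OF W(1)] W(3-7) assms(2)[OF W(1)]])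
  with W(1,2) show ?thesis by (rule that)
qed

lemma smooth_map_near_iff_smooth_via:
  assumes M: "smooth_manifold M"
  shows "smooth_map_near M M' f p \<longleftrightarrow> (\<exists>c\<in>atlas M. \<exists>d\<in>atlas M'. smooth_via c d f p)"
proof
  assume "smooth_map_near M M' f p"
  then show "\<exists>c\<in>atlas M. \<exists>d\<in>atlas M'. smooth_via c d f p"
    by (rule smooth_map_near_imp_smooth_via[rotated 2])
       (use smooth_manifold_coordinate_embedding[OF M] is_chart_model[OF smooth_manifold_chart[OF M]]
         in blast)+
next
  assume "\<exists>c\<in>atlas M. \<exists>d\<in>atlas M'. smooth_via c d f p"
  then obtain c d where cd: "c \<in> atlas M" "d \<in> atlas M'" "smooth_via c d f p" by blast
  then have "p \<in> fst c" "\<exists>W. open W \<and> p \<in> W \<and> f ` W \<subseteq> fst d" unfolding smooth_via_def by blast+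
  then show "smooth_map_near M M' f p"
    unfolding smooth_map_near_def
    using cd smooth_via_imp_smooth_near[OF smooth_manifold_chart[OF M]] by blast
qed

lemma smooth_via_transition:
  assumes M: "smooth_manifold M" and c: "c \<in> atlas M" "d \<in> atlas M" "p \<in> fst c" "p \<in> fst d"
  shows "smooth_via c d (\<lambda>x. x) p"
proof (rule smooth_near_imp_smooth_via[where W = "fst d"])
  have "smooth_near (model M) (snd c p) (snd d \<circ> chart_inv c)"
    using assms by (auto simp: smooth_manifold_def smooth_transition_def)
  then show "smooth_near (model M) (snd c p) (snd d \<circ> (\<lambda>x. x) \<circ> chart_inv c)"
    by (simp add: comp_def)
  show "open (fst d)" using smooth_manifold_chart[OF M c(2)] by (simp add: is_chart_def)
qed (use c smooth_manifold_coordinate_embedding[OF M c(1)] is_chart_model[OF smooth_manifold_chart[OF M c(1)]]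
      in auto)

lemma smooth_via_change_charts:
  assumes M: "smooth_manifold M" "c \<in> atlas M" "c' \<in> atlas M" "p \<in> fst c'"
    and M': "smooth_manifold M'" "d \<in> atlas M'" "d' \<in> atlas M'" "f p \<in> fst d'"
    and f: "smooth_via c d f p"
  shows "smooth_via c' d' f p"
proof -
  have p: "p \<in> fst c" "f p \<in> fst d" using f by (auto simp: smooth_via_def)
  note e = smooth_manifold_coordinate_embedding[OF M(1)] smooth_manifold_coordinate_embedding[OF M'(1)]
  have "smooth_via c' d f p"
    using smooth_via_compose[where f = "\<lambda>x. x" and g = f,
        OF e(1)[OF M(3)] e(1)[OF M(2)] smooth_via_transition[OF M(1) M(3,2,4) p(1)]] f
    by blast
  then show ?thesis
    by (rule smooth_via_compose[where f = f and g = "\<lambda>x. x",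
        OF e(1)[OF M(3)] e(2)[OF M'(2)] _ smooth_via_transition[OF M'(1-3) p(2) M'(4)]])
qed

lemma smooth_map_near_smooth_via:
  assumes "smooth_manifold M" "smooth_manifold M'" "smooth_map_near M M' f p"
    "c \<in> atlas M" "p \<in> fst c" "d \<in> atlas M'" "f p \<in> fst d"
  shows "smooth_via c d f p"
proof -
  obtain c0 d0 where "c0 \<in> atlas M" "d0 \<in> atlas M'" "smooth_via c0 d0 f p"
    using assms(3) smooth_map_near_iff_smooth_via[OF assms(1)] by blast
  then show ?thesis
    using smooth_via_change_charts[where f = f and p = p, OF assms(1) _ assms(4,5,2) _ assms(6,7)] by blast
qed

lemma smooth_map_near_cong:
  assumes "smooth_manifold M" "smooth_map_near M M' f p" "open W" "p \<in> W" "\<And>x. x \<in> W \<Longrightarrow> g x = f x"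
  shows "smooth_map_near M M' g p"
  using assms(2) smooth_via_cong[where f = f and g = g, OF _ assms(3-5)]
  unfolding smooth_map_near_iff_smooth_via[OF assms(1)] by blast

lemma smooth_map_near_nbhd:
  assumes M: "smooth_manifold M" "smooth_manifold M'" "smooth_map_near M M' f p" and V: "open V" "f p \<in> V"
  obtains W where "open W" "p \<in> W" "f ` W \<subseteq> V"
proof -
  obtain c d where "c \<in> atlas M" "d \<in> atlas M'" "smooth_via c d f p"
    using M(3) smooth_map_near_iff_smooth_via[OF M(1)] by blast
  then show ?thesis
    using smooth_via_nbhd[where f = f and p = p, OF smooth_manifold_coordinate_embedding[OF M(1)]
        smooth_manifold_coordinate_embedding[OF M(2)] _ V] that by blast
qed

lemma smooth_map_near_compose:
  assumes M: "smooth_manifold M" "smooth_manifold M'"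
    and f: "smooth_map_near M M' f p" and g: "smooth_map_near M' M'' g (f p)"
  shows "smooth_map_near M M'' (\<lambda>x. g (f x)) p"
proof -
  obtain d e where d: "d \<in> atlas M'" "e \<in> atlas M''" "smooth_via d e g (f p)"
    using g smooth_map_near_iff_smooth_via[OF M(2)] by blast
  then have "f p \<in> fst d" by (auto simp: smooth_via_def)
  obtain c where c: "c \<in> atlas M" "p \<in> fst c" using smooth_manifold_chart_at[OF M(1)] .
  have "smooth_via c d f p"
    using smooth_map_near_smooth_via[OF M f c d(1)] \<open>f p \<in> fst d\<close> by blast
  then have "smooth_via c e (\<lambda>x. g (f x)) p"
    by (rule smooth_via_compose[where f = f and g = g, OF smooth_manifold_coordinate_embedding[OF M(1) c(1)]
        smooth_manifold_coordinate_embedding[OF M(2) d(1)] _ d(3)])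
  then show ?thesis using c d smooth_map_near_iff_smooth_via[OF M(1)] by blast
qed

lemma smooth_via_Pair:
  assumes "smooth_via c d f p" "smooth_via c d' g p"
  shows "smooth_via c (fst d \<times> fst d', map_prod (snd d) (snd d')) (\<lambda>x. (f x, g x)) p"
proof -
  obtain W U F where W: "open W" "p \<in> W" "W \<subseteq> fst c" "f ` W \<subseteq> fst d"
     "smooth_on_open U F" "\<forall>x\<in>W. snd c x \<in> U \<and> snd d (f x) = F (snd c x)"
    using assms(1) unfolding smooth_via_def by blast
  obtain W' U' F' where W': "open W'" "p \<in> W'" "W' \<subseteq> fst c" "g ` W' \<subseteq> fst d'"
     "smooth_on_open U' F'" "\<forall>x\<in>W'. snd c x \<in> U' \<and> snd d' (g x) = F' (snd c x)"
    using assms(2) unfolding smooth_via_def by blast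
  have "smooth_on_open (U \<inter> U') (\<lambda>x. (F x, F' x))"
    using W(5) W'(5) unfolding smooth_on_open_def
    by (auto intro!: C_k_on_Pair intro: C_k_on_subset)
  then show ?thesis
    unfolding smooth_via_def using W W'
    by (intro exI[of _ "W \<inter> W'"] exI[of _ "U \<inter> U'"] exI[of _ "\<lambda>x. (F x, F' x)"]) auto
qed

lemma prod_manifold_atlasE:
  assumes "e \<in> atlas (prod_manifold M M')"
  obtains c d where "c \<in> atlas M" "d \<in> atlas M'" "e = (fst c \<times> fst d, map_prod (snd c) (snd d))"
proof -
  have "\<exists>c d. e = (fst c \<times> fst d, map_prod (snd c) (snd d)) \<and> c \<in> atlas M \<and> d \<in> atlas M'"
    using assms by (simp add: prod_manifold_def)
  then show ?thesis using that by blast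
qed

text \<open>The multiplication of a Lie groupoid is smooth for the product atlas, so its composites with pairs of
  smooth maps are needed.  An atlas chart of the product is a pair of charts, and each component map can be
  read in the matching one.\<close>

lemma smooth_map_near_compose_pair:
  assumes M: "smooth_manifold M" "smooth_manifold M1" "smooth_manifold M2"
    and f: "smooth_map_near M M1 f p" and g: "smooth_map_near M M2 g p"
    and m: "smooth_map_near (prod_manifold M1 M2) M3 m (f p, g p)"
  shows "smooth_map_near M M3 (\<lambda>x. m (f x, g x)) p"
proof -
  let ?P = "\<lambda>d d'. (fst d \<times> fst d', map_prod (snd d) (snd d'))"
  have emb: "coordinate_embedding e" if e: "e \<in> atlas (prod_manifold M1 M2)" for e
  proof -
    obtain d d' where "d \<in> atlas M1" "d' \<in> atlas M2" "e = ?P d d'"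
      using e by (rule prod_manifold_atlasE)
    then show ?thesis
      using coordinate_embedding_product[of d d'] smooth_manifold_coordinate_embedding[OF M(2)]
        smooth_manifold_coordinate_embedding[OF M(3)] by simp
  qed
  have "snd e x \<in> model (prod_manifold M1 M2)" if "e \<in> atlas (prod_manifold M1 M2)" "x \<in> fst e" for e x
    using that(1)
  proof (rule prod_manifold_atlasE)
    fix c d assume "c \<in> atlas M1" "d \<in> atlas M2" "e = ?P c d"
    then show ?thesis
      using that(2) is_chart_model[OF smooth_manifold_chart[OF M(2)], of c]
        is_chart_model[OF smooth_manifold_chart[OF M(3)], of d]
      by (auto simp: prod_manifold_def)
  qed
  then obtain d0 e where d0: "d0 \<in> atlas (prod_manifold M1 M2)" and e: "e \<in> atlas M3"
      and m': "smooth_via d0 e m (f p, g p)"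
    using smooth_map_near_imp_smooth_via[OF emb _ m] by blast
  obtain d d' where d: "d \<in> atlas M1" "d' \<in> atlas M2" "d0 = ?P d d'"
    using d0 by (rule prod_manifold_atlasE)
  then have fp: "f p \<in> fst d" "g p \<in> fst d'" using m' by (auto simp: smooth_via_def)
  obtain c where c: "c \<in> atlas M" "p \<in> fst c" using smooth_manifold_chart_at[OF M(1)] .
  have "smooth_via c d0 (\<lambda>x. (f x, g x)) p"
    unfolding d(3)
    by (intro smooth_via_Pair smooth_map_near_smooth_via[OF M(1,2) f c d(1) fp(1)]
        smooth_map_near_smooth_via[OF M(1,3) g c d(2) fp(2)])
  then have "smooth_via c e (\<lambda>x. m (f x, g x)) p"
    using smooth_via_compose[of c d0 "\<lambda>x. (f x, g x)" p e m] m' emb[OF d0]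
      smooth_manifold_coordinate_embedding[OF M(1) c(1)] by simp
  then show ?thesis using c e smooth_map_near_iff_smooth_via[OF M(1)] by blast
qed

lemma smooth_on_open_const: "open U \<Longrightarrow> smooth_on_open U (\<lambda>x. a)"
  by (simp add: smooth_on_open_def C_k_on_const)

lemma smooth_map_near_const:
  assumes "smooth_manifold M" "smooth_manifold M'"
  shows "smooth_map_near M M' (\<lambda>x. a) p"
proof -
  obtain c where c: "c \<in> atlas M" "p \<in> fst c" using smooth_manifold_chart_at[OF assms(1)] .
  obtain d where d: "d \<in> atlas M'" "a \<in> fst d" using smooth_manifold_chart_at[OF assms(2)] .
  have "open (fst c)" using smooth_manifold_chart[OF assms(1) c(1)] by (simp add: is_chart_def)
  then have "smooth_via c d (\<lambda>x. a) p"
    unfolding smooth_via_def using c d smooth_on_open_const[of UNIV "snd d a"]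
    by (intro exI[of _ "fst c"] exI[of _ UNIV] exI[of _ "\<lambda>x. snd d a"]) auto
  then show ?thesis using c d smooth_map_near_iff_smooth_via[OF assms(1)] by blast
qed

lemma smooth_map_near_id:
  assumes "smooth_manifold M"
  shows "smooth_map_near M M (\<lambda>x. x) p"
proof -
  obtain c where c: "c \<in> atlas M" "p \<in> fst c" using smooth_manifold_chart_at[OF assms(1)] .
  then show ?thesis
    using smooth_map_near_iff_smooth_via[OF assms(1)] smooth_via_transition[OF assms] by blast
qed


section \<open>Smoothness along subsets\<close>

lemma smooth_map_at_UNIV_iff:
  assumes "smooth_manifold M"
  shows "smooth_map_at M UNIV M' f p \<longleftrightarrow> smooth_map_near M M' f p"
proof
  assume "smooth_map_at M UNIV M' f p"
  then obtain W F where "open W" "p \<in> W" "smooth_map_near M M' F p" "\<forall>x\<in>W. f x = F x"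
    unfolding smooth_map_at_def by auto
  then show "smooth_map_near M M' f p"
    using smooth_map_near_cong[where f = F and g = f, OF assms] by blast
next
  assume "smooth_map_near M M' f p"
  then show "smooth_map_at M UNIV M' f p" unfolding smooth_map_at_def by auto
qed

lemma smooth_map_at_subset: "smooth_map_at M S M' f p \<Longrightarrow> T \<subseteq> S \<Longrightarrow> smooth_map_at M T M' f p"
  unfolding smooth_map_at_def by blast

lemma smooth_map_near_imp_at: "smooth_map_near M M' f p \<Longrightarrow> smooth_map_at M S M' f p"
  unfolding smooth_map_at_def by (intro exI[of _ UNIV] exI[of _ f]) auto

lemma smooth_map_at_compose:
  assumes M: "smooth_manifold M" "smooth_manifold M'" and p: "p \<in> S"
    and f: "smooth_map_at M S M' f p" and g: "smooth_map_at M' S' M'' g (f p)"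
    and S': "\<And>x. x \<in> S \<Longrightarrow> f x \<in> S'"
  shows "smooth_map_at M S M'' (\<lambda>x. g (f x)) p"
proof -
  obtain W F where W: "open W" "p \<in> W" "smooth_map_near M M' F p" "\<forall>x\<in>W \<inter> S. f x = F x"
    using f unfolding smooth_map_at_def by blast
  obtain V H where V: "open V" "f p \<in> V" "smooth_map_near M' M'' H (f p)" "\<forall>x\<in>V \<inter> S'. g x = H x"
    using g unfolding smooth_map_at_def by blast
  have eq: "f p = F p" using W(2,4) p by simp
  have "F p \<in> V" using V(2) eq by simp
  then obtain W' where W': "open W'" "p \<in> W'" "F ` W' \<subseteq> V"
    using smooth_map_near_nbhd[OF M W(3) V(1)] by blast
  have "smooth_map_near M M'' (\<lambda>x. H (F x)) p"
    using smooth_map_near_compose[OF M W(3)] V(3) eq by simp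
  moreover have "g (f x) = H (F x)" if "x \<in> W \<inter> W' \<inter> S" for x
  proof -
    have "f x \<in> S'" using that S' by simp
    moreover have "f x = F x" "F x \<in> V" using that W(4) W'(3) by auto
    ultimately show ?thesis using V(4) by simp
  qed
  ultimately show ?thesis
    unfolding smooth_map_at_def using W W'
    by (intro exI[of _ "W \<inter> W'"] exI[of _ "\<lambda>x. H (F x)"]) auto
qed

lemma smooth_map_at_compose_pair:
  assumes M: "smooth_manifold M" "smooth_manifold M1" "smooth_manifold M2" and p: "p \<in> S"
    and f: "smooth_map_at M S M1 f p" and g: "smooth_map_at M S M2 g p"
    and m: "smooth_map_at (prod_manifold M1 M2) T M3 m (f p, g p)"
    and T: "\<And>x. x \<in> S \<Longrightarrow> (f x, g x) \<in> T"
  shows "smooth_map_at M S M3 (\<lambda>x. m (f x, g x)) p"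
proof -
  obtain W F where W: "open W" "p \<in> W" "smooth_map_near M M1 F p" "\<forall>x\<in>W \<inter> S. f x = F x"
    using f unfolding smooth_map_at_def by blast
  obtain W1 F1 where W1: "open W1" "p \<in> W1" "smooth_map_near M M2 F1 p" "\<forall>x\<in>W1 \<inter> S. g x = F1 x"
    using g unfolding smooth_map_at_def by blast
  have eq: "f p = F p" "g p = F1 p" using W(2,4) W1(2,4) p by simp_all
  have m': "smooth_map_at (prod_manifold M1 M2) T M3 m (F p, F1 p)" using m by (simp only: eq)
  obtain V H where V: "open V" "(F p, F1 p) \<in> V" "smooth_map_near (prod_manifold M1 M2) M3 H (F p, F1 p)"
      "\<forall>x\<in>V \<inter> T. m x = H x"
    using m' unfolding smooth_map_at_def by blast
  obtain A B where "open A" "open B" "(F p, F1 p) \<in> A \<times> B" "A \<times> B \<subseteq> V"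
    using V(1,2) by (rule open_prod_elim)
  then have AB: "open A" "open B" "F p \<in> A" "F1 p \<in> B" "A \<times> B \<subseteq> V" by simp_all
  obtain W2 where W2: "open W2" "p \<in> W2" "F ` W2 \<subseteq> A"
    using smooth_map_near_nbhd[OF M(1,2) W(3) AB(1,3)] .
  obtain W3 where W3: "open W3" "p \<in> W3" "F1 ` W3 \<subseteq> B"
    using smooth_map_near_nbhd[OF M(1,3) W1(3) AB(2,4)] .
  have "smooth_map_near M M3 (\<lambda>x. H (F x, F1 x)) p"
    using smooth_map_near_compose_pair[OF M W(3) W1(3) V(3)] .
  moreover have "m (f x, g x) = H (F x, F1 x)" if "x \<in> W \<inter> W1 \<inter> W2 \<inter> W3 \<inter> S" for x
  proof -
    have "(f x, g x) \<in> T" using that T by simp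
    moreover have "f x = F x" "g x = F1 x" using that W(4) W1(4) by simp_all
    moreover have "(F x, F1 x) \<in> V" using that W2(3) W3(3) AB(5) by blast
    ultimately show ?thesis using V(4) by simp
  qed
  ultimately show ?thesis
    unfolding smooth_map_at_def using W W1 W2 W3
    by (intro exI[of _ "W \<inter> W1 \<inter> W2 \<inter> W3"] exI[of _ "\<lambda>x. H (F x, F1 x)"]) auto
qed

lemma smooth_manifold_real_line: "smooth_manifold real_line"
proof -
  have "smooth_near UNIV p (\<lambda>x::real. x)" for p
    unfolding smooth_near_def
    by (intro exI[of _ UNIV] exI[of _ "\<lambda>x. x"])
       (simp add: smooth_on_open_def C_k_on_linear[OF bounded_linear_ident])
  moreover have "inv_into UNIV (\<lambda>x::real. x) = (\<lambda>x. x)"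
    using inv_id unfolding id_def .
  moreover have "homeomorphism UNIV UNIV (\<lambda>x::real. x) (\<lambda>x. x)"
    by (auto simp: homeomorphism_def)
  ultimately show ?thesis
    by (simp add: smooth_manifold_def real_line_def is_chart_def smooth_transition_def chart_inv_def comp_def)
qed

section \<open>Smooth real functions on a manifold\<close>

abbreviation real_chart :: "(real, real) chart" where
  "real_chart \<equiv> (UNIV, \<lambda>x. x)"

lemma real_chart_in_atlas: "real_chart \<in> atlas real_line"
  by (simp add: real_line_def)

lemma smooth_function_near_coordinates:
  assumes "smooth_manifold M" "c \<in> atlas M" "p \<in> fst c" "smooth_map_near M real_line f p"
  obtains W U F where "open W" "p \<in> W" "W \<subseteq> fst c" "smooth_on_open U F"
    "\<And>x. x \<in> W \<Longrightarrow> snd c x \<in> U" "\<And>x. x \<in> W \<Longrightarrow> f x = F (snd c x)"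
proof -
  have "smooth_via c real_chart f p"
    by (rule smooth_map_near_smooth_via[OF assms(1) smooth_manifold_real_line assms(4,2,3) real_chart_in_atlas]) simp
  then show ?thesis using that unfolding smooth_via_def by auto
qed

lemma smooth_function_nearI:
  assumes "smooth_manifold M" "c \<in> atlas M"
    and "open W" "p \<in> W" "W \<subseteq> fst c" "smooth_on_open U F"
    "\<And>x. x \<in> W \<Longrightarrow> snd c x \<in> U" "\<And>x. x \<in> W \<Longrightarrow> f x = F (snd c x)"
  shows "smooth_map_near M real_line f p"
proof -
  have "smooth_via c real_chart f p"
    unfolding smooth_via_def using assms(3-) by (intro exI[of _ W] exI[of _ U] exI[of _ F]) simp
  then show ?thesis
    using smooth_map_near_iff_smooth_via[OF assms(1)] assms(2) real_chart_in_atlas by blast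
qed

lemma smooth_on_open_subset: "smooth_on_open U F \<Longrightarrow> open V \<Longrightarrow> V \<subseteq> U \<Longrightarrow> smooth_on_open V F"
  using C_k_on_subset unfolding smooth_on_open_def by blast

lemma smooth_on_open_linear: "bounded_linear F \<Longrightarrow> open U \<Longrightarrow> smooth_on_open U F"
  by (simp add: smooth_on_open_def C_k_on_linear)

lemma smooth_function_near_combine:
  fixes op :: "real \<Rightarrow> real \<Rightarrow> real"
  assumes M: "smooth_manifold M" and f: "smooth_map_near M real_line f p" and g: "smooth_map_near M real_line g p"
    and op: "\<And>U F G k. open U \<Longrightarrow> C_k_on k U F \<Longrightarrow> C_k_on k U G \<Longrightarrow> C_k_on k U (\<lambda>x::'e::euclidean_space. op (F x) (G x))"
  shows "smooth_map_near (M :: ('a::{t2_space, second_countable_topology}, 'e) manifold) real_line (\<lambda>x. op (f x) (g x)) p"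
proof -
  obtain c where c: "c \<in> atlas M" "p \<in> fst c" using smooth_manifold_chart_at[OF M] .
  obtain W U F where W: "open W" "p \<in> W" "W \<subseteq> fst c" "smooth_on_open U F"
    "\<And>x. x \<in> W \<Longrightarrow> snd c x \<in> U" "\<And>x. x \<in> W \<Longrightarrow> f x = F (snd c x)"
    using smooth_function_near_coordinates[OF M c f] by blast
  obtain W' U' F' where W': "open W'" "p \<in> W'" "W' \<subseteq> fst c" "smooth_on_open U' F'"
    "\<And>x. x \<in> W' \<Longrightarrow> snd c x \<in> U'" "\<And>x. x \<in> W' \<Longrightarrow> g x = F' (snd c x)"
    using smooth_function_near_coordinates[OF M c g] by blast
  have o: "open (U \<inter> U')" using W(4) W'(4) by (auto simp: smooth_on_open_def)
  have "smooth_on_open (U \<inter> U') F" "smooth_on_open (U \<inter> U') F'"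
    using smooth_on_open_subset[OF W(4) o] smooth_on_open_subset[OF W'(4) o] by auto
  then have s: "smooth_on_open (U \<inter> U') (\<lambda>x. op (F x) (F' x))"
    using op[OF o] by (simp add: smooth_on_open_def)
  show ?thesis
    by (rule smooth_function_nearI[OF M c(1) _ _ _ s, of "W \<inter> W'"]) (use W W' in auto)
qed

lemma smooth_function_near_add:
  assumes "smooth_manifold M" "smooth_map_near M real_line f p" "smooth_map_near M real_line g p"
  shows "smooth_map_near M real_line (\<lambda>x. f x + g x) p"
  using smooth_function_near_combine[OF assms, of "(+)"] C_k_on_add by blast

lemma smooth_function_near_mult:
  assumes "smooth_manifold M" "smooth_map_near M real_line f p" "smooth_map_near M real_line g p"
  shows "smooth_map_near M real_line (\<lambda>x. f x * g x) p"
  using smooth_function_near_combine[OF assms, of "(*)"] C_k_on_bilinear[OF bounded_bilinear_mult] by blast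

lemma smooth_function_near_scale:
  assumes "smooth_manifold M" "smooth_map_near M real_line f p"
  shows "smooth_map_near M real_line (\<lambda>x. a * f x) p"
  using smooth_function_near_mult[OF assms(1) smooth_map_near_const[OF assms(1) smooth_manifold_real_line] assms(2)] .

lemma smooth_funs_atE:
  assumes "f \<in> smooth_funs_at M S p"
  obtains W F where "open W" "p \<in> W" "smooth_map_near M real_line F p" "\<And>x. x \<in> W \<inter> S \<Longrightarrow> f x = F x"
  using assms unfolding smooth_funs_at_def smooth_map_at_def by auto

lemma smooth_funs_atI:
  assumes "open W" "p \<in> W" "smooth_map_near M real_line F p" "\<And>x. x \<in> W \<inter> S \<Longrightarrow> f x = F x"
  shows "f \<in> smooth_funs_at M S p"
  using assms unfolding smooth_funs_at_def smooth_map_at_def by blast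

lemma smooth_funs_at_UNIV_iff:
  "smooth_manifold M \<Longrightarrow> f \<in> smooth_funs_at M UNIV p \<longleftrightarrow> smooth_map_near M real_line f p"
  by (simp add: smooth_funs_at_def smooth_map_at_UNIV_iff)

lemma smooth_funs_at_near: "smooth_map_near M real_line f p \<Longrightarrow> f \<in> smooth_funs_at M S p"
  by (simp add: smooth_funs_at_def smooth_map_near_imp_at)

lemma smooth_funs_at_add_mult:
  assumes M: "smooth_manifold M" and f: "f \<in> smooth_funs_at M S p" and g: "g \<in> smooth_funs_at M S p"
  shows "(\<lambda>x. f x + g x) \<in> smooth_funs_at M S p" "(\<lambda>x. f x * g x) \<in> smooth_funs_at M S p"
proof -
  obtain W F where W: "open W" "p \<in> W" "smooth_map_near M real_line F p" "\<And>x. x \<in> W \<inter> S \<Longrightarrow> f x = F x"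
    using smooth_funs_atE[OF f] by blast
  obtain V G where V: "open V" "p \<in> V" "smooth_map_near M real_line G p" "\<And>x. x \<in> V \<inter> S \<Longrightarrow> g x = G x"
    using smooth_funs_atE[OF g] by blast
  have o: "open (W \<inter> V)" "p \<in> W \<inter> V" using W V by auto
  show "(\<lambda>x. f x + g x) \<in> smooth_funs_at M S p"
    by (rule smooth_funs_atI[OF o smooth_function_near_add[OF M W(3) V(3)]]) (use W(4) V(4) in simp)
  show "(\<lambda>x. f x * g x) \<in> smooth_funs_at M S p"
    by (rule smooth_funs_atI[OF o smooth_function_near_mult[OF M W(3) V(3)]]) (use W(4) V(4) in simp)
qed

lemma smooth_funs_at_const: "smooth_manifold M \<Longrightarrow> (\<lambda>x. a) \<in> smooth_funs_at M S p"
  by (simp add: smooth_funs_at_near smooth_map_near_const smooth_manifold_real_line)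

lemma smooth_funs_at_scale:
  "smooth_manifold M \<Longrightarrow> f \<in> smooth_funs_at M S p \<Longrightarrow> (\<lambda>x. a * f x) \<in> smooth_funs_at M S p"
  using smooth_funs_at_add_mult(2) smooth_funs_at_const by blast

lemma smooth_funs_at_compose:
  assumes "smooth_manifold M" "smooth_manifold M'" "p \<in> S" "smooth_map_at M S M' f p"
    "\<phi> \<in> smooth_funs_at M' S' (f p)" "\<And>x. x \<in> S \<Longrightarrow> f x \<in> S'"
  shows "\<phi> \<circ> f \<in> smooth_funs_at M S p"
  using smooth_map_at_compose[where f = f and g = \<phi> and M'' = real_line, OF assms(1-4) _ assms(6)] assms(5)
  by (simp add: smooth_funs_at_def comp_def)


section \<open>Tangent vectors as derivations\<close>

lemma tangent_space_add:
  "v \<in> tangent_space M S p \<Longrightarrow> f \<in> smooth_funs_at M S p \<Longrightarrow> g \<in> smooth_funs_at M S p \<Longrightarrow>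
    v (\<lambda>x. f x + g x) = v f + v g"
  by (simp add: tangent_space_def)

lemma tangent_space_mult:
  "v \<in> tangent_space M S p \<Longrightarrow> f \<in> smooth_funs_at M S p \<Longrightarrow> g \<in> smooth_funs_at M S p \<Longrightarrow>
    v (\<lambda>x. f x * g x) = v f * g p + f p * v g"
  by (simp add: tangent_space_def)

lemma tangent_space_scale:
  "v \<in> tangent_space M S p \<Longrightarrow> f \<in> smooth_funs_at M S p \<Longrightarrow> v (\<lambda>x. a * f x) = a * v f"
  by (simp add: tangent_space_def)

lemma tangent_space_nonsmooth: "v \<in> tangent_space M S p \<Longrightarrow> f \<notin> smooth_funs_at M S p \<Longrightarrow> v f = 0"
  by (simp add: tangent_space_def)

lemma tangent_space_const:
  assumes "smooth_manifold M" "v \<in> tangent_space M S p"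
  shows "v (\<lambda>x. a) = 0"
proof -
  note one = smooth_funs_at_const[OF assms(1), of 1 S p]
  have "v (\<lambda>x. 1) = 0" using tangent_space_mult[OF assms(2) one one] by simp
  then show ?thesis using tangent_space_scale[OF assms(2) one, of a] by simp
qed

lemma tangent_space_sum:
  assumes M: "smooth_manifold M" and v: "v \<in> tangent_space M S p" and I: "finite I"
    and f: "\<And>i. i \<in> I \<Longrightarrow> f i \<in> smooth_funs_at M S p"
  shows "(\<lambda>x. \<Sum>i\<in>I. f i x) \<in> smooth_funs_at M S p \<and> v (\<lambda>x. \<Sum>i\<in>I. f i x) = (\<Sum>i\<in>I. v (f i))"
  using I f
proof (induction I)
  case empty
  then show ?case using smooth_funs_at_const[OF M] tangent_space_const[OF M v] by simp
next
  case (insert i I)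
  have i: "f i \<in> smooth_funs_at M S p" using insert.prems by simp
  have I: "(\<lambda>x. \<Sum>i\<in>I. f i x) \<in> smooth_funs_at M S p" "v (\<lambda>x. \<Sum>i\<in>I. f i x) = (\<Sum>i\<in>I. v (f i))"
    using insert.IH insert.prems by simp_all
  show ?case
    using smooth_funs_at_add_mult(1)[OF M i I(1)] tangent_space_add[OF v i I(1)] I(2) insert.hyps by simp
qed

text \<open>The indicator of \<open>W \<inter> S\<close> serves as a bump function: it agrees with the constant 1 on \<open>S\<close> near \<open>p\<close>, hence
  it is smooth near \<open>p\<close>, and \<open>f\<close> and \<open>g\<close> have the same product with it.  The Leibniz rule at \<open>p\<close> finishes the argument.\<close>

lemma tangent_space_local:
  assumes M: "smooth_manifold M" and v: "v \<in> tangent_space M S p" and p: "p \<in> S"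
    and f: "f \<in> smooth_funs_at M S p"
    and W: "open W" "p \<in> W" and eq: "\<And>x. x \<in> W \<inter> S \<Longrightarrow> f x = g x"
  shows "v f = v g"
proof -
  obtain V F where V: "open V" "p \<in> V" "smooth_map_near M real_line F p" "\<And>x. x \<in> V \<inter> S \<Longrightarrow> f x = F x"
    using smooth_funs_atE[OF f] by blast
  have g: "g \<in> smooth_funs_at M S p"
    by (rule smooth_funs_atI[OF _ _ V(3), of "V \<inter> W"]) (use V(1,2,4) W eq[symmetric] in auto)
  define ind :: "'a \<Rightarrow> real" where "ind x = (if x \<in> W \<inter> S then 1 else 0)" for x
  have ind: "ind \<in> smooth_funs_at M S p"
    by (rule smooth_funs_atI[OF W, of _ "\<lambda>x. 1"])
       (simp_all add: ind_def smooth_map_near_const M smooth_manifold_real_line)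
  have "(\<lambda>x. f x * ind x) = (\<lambda>x. g x * ind x)" using eq by (auto simp: ind_def)
  then have "v f * ind p + f p * v ind = v g * ind p + g p * v ind"
    using tangent_space_mult[OF v f ind] tangent_space_mult[OF v g ind] by simp
  then show ?thesis using p W eq by (simp add: ind_def)
qed

lemma coordinate_function_smooth:
  fixes M :: "('a::{t2_space, second_countable_topology}, 'e::euclidean_space) manifold"
  assumes M: "smooth_manifold M" and c: "c \<in> atlas M" "p \<in> fst c"
  shows "smooth_map_near M real_line (\<lambda>x. snd c x \<bullet> u) p"
proof (rule smooth_function_nearI[OF M c(1), of "fst c" _ UNIV "\<lambda>y. y \<bullet> u"])
  show "open (fst c)" using smooth_manifold_chart[OF M c(1)] by (simp add: is_chart_def)
qed (use c in \<open>auto intro!: smooth_on_open_linear bounded_linear_inner_left\<close>)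

lemma subspace_memI_orthogonal:
  fixes E :: "'e::euclidean_space set"
  assumes "subspace E" "\<And>u. (\<And>y. y \<in> E \<Longrightarrow> y \<bullet> u = 0) \<Longrightarrow> x \<bullet> u = 0"
  shows "x \<in> E"
proof -
  obtain y z where yz: "y \<in> span E" "\<And>w. w \<in> span E \<Longrightarrow> orthogonal z w" "x = y + z"
    using orthogonal_subspace_decomp_exists[of E x] by blast
  have sp: "span E = E" using assms(1) by (simp add: span_eq_iff)
  have z: "w \<bullet> z = 0" if "w \<in> E" for w
    using yz(2)[of w] that sp by (simp add: orthogonal_def inner_commute)
  then have "x \<bullet> z = 0" by (rule assms(2))
  moreover have "y \<bullet> z = 0" using z yz(1) sp by simp
  ultimately have "z \<bullet> z = 0" using yz(3) by (simp add: inner_add_left)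
  then show ?thesis using yz(1,3) sp by simp
qed

text \<open>Every derivation is the directional derivative along its vector \<open>\<xi>\<close> of values on the coordinate functions.
  By Hadamard's lemma a smooth function is a constant plus a sum of products of coordinate differences, which
  vanish at \<open>p\<close>, with smooth factors whose values at \<open>p\<close> are the partial derivatives; the Leibniz rule
  evaluates the derivation on such a sum.  The vector \<open>\<xi>\<close> lies in the model subspace since linear functions
  that vanish on that subspace have zero composite with the chart.\<close>

lemma tangent_vector_coordinates:
  fixes M :: "('a::{t2_space, second_countable_topology}, 'e::euclidean_space) manifold"
  assumes M: "smooth_manifold M" and v: "v \<in> tangent_space M UNIV p" and c: "c \<in> atlas M" "p \<in> fst c"
  obtains \<xi> where "\<xi> \<in> model M"
    "\<And>f W U F F'. open W \<Longrightarrow> p \<in> W \<Longrightarrow> W \<subseteq> fst c \<Longrightarrow> smooth_on_open U F \<Longrightarrow>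
       (\<And>x. x \<in> W \<Longrightarrow> snd c x \<in> U) \<Longrightarrow> (\<And>x. x \<in> W \<Longrightarrow> f x = F (snd c x)) \<Longrightarrow>
       (F has_derivative F') (at (snd c p)) \<Longrightarrow> v f = F' \<xi>"
proof -
  define \<xi> where "\<xi> = (\<Sum>b\<in>Basis. v (\<lambda>x. snd c x \<bullet> b) *\<^sub>R b)"
  have cs: "(\<lambda>x. snd c x \<bullet> b) \<in> smooth_funs_at M UNIV p" for b
    using coordinate_function_smooth[OF M c] by (rule smooth_funs_at_near)
  have oc: "open (fst c)" using smooth_manifold_chart[OF M c(1)] by (simp add: is_chart_def)
  have in_model: "snd c x \<in> model M" if "x \<in> fst c" for x
    using is_chart_model[OF smooth_manifold_chart[OF M c(1)] that] .
  show ?thesis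
  proof (rule that)
    show "\<xi> \<in> model M"
    proof (rule subspace_memI_orthogonal)
      show "subspace (model M)" using M by (simp add: smooth_manifold_def)
      fix u assume u: "\<And>y. y \<in> model M \<Longrightarrow> y \<bullet> u = 0"
      have "\<xi> \<bullet> u = (\<Sum>b\<in>Basis. (b \<bullet> u) * v (\<lambda>x. snd c x \<bullet> b))"
        by (simp add: \<xi>_def inner_sum_left mult.commute)
      also have "\<dots> = (\<Sum>b\<in>Basis. v (\<lambda>x. (b \<bullet> u) * (snd c x \<bullet> b)))"
        using tangent_space_scale[OF v cs] by simp
      also have "\<dots> = v (\<lambda>x. \<Sum>b\<in>Basis. (b \<bullet> u) * (snd c x \<bullet> b))"
        using tangent_space_sum[OF M v finite_Basis, of "\<lambda>b x. (b \<bullet> u) * (snd c x \<bullet> b)"]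
          smooth_funs_at_scale[OF M cs] by simp
      also have "\<dots> = v (\<lambda>x. snd c x \<bullet> u)"
        by (rule arg_cong[of _ _ v], rule ext, subst (2) euclidean_inner) (simp add: mult.commute inner_commute)
      also have "\<dots> = v (\<lambda>x. 0)"
        by (rule tangent_space_local[OF M v _ cs oc c(2)]) (use u in_model in auto)
      also have "\<dots> = 0" using tangent_space_const[OF M v] .
      finally show "\<xi> \<bullet> u = 0" .
    qed
  next
    fix f W U F' and F :: "'e \<Rightarrow> real"
    assume W: "open W" "p \<in> W" "W \<subseteq> fst c" and F: "smooth_on_open U F"
      and cU: "\<And>x. x \<in> W \<Longrightarrow> snd c x \<in> U" and fF: "\<And>x. x \<in> W \<Longrightarrow> f x = F (snd c x)"
      and F': "(F has_derivative F') (at (snd c p))"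
    let ?p = "snd c p"
    obtain r and g :: "'e \<Rightarrow> 'e \<Rightarrow> real" where r: "r > 0" "ball ?p r \<subseteq> U" and g: "\<And>b. smooth_on_open (ball ?p r) (g b)"
      and gp: "\<And>b. g b ?p = frechet_derivative F (at ?p) b"
      and Fg: "\<And>y. y \<in> ball ?p r \<Longrightarrow> F y = F ?p + (\<Sum>b\<in>Basis. ((y - ?p) \<bullet> b) * g b y)"
      using hadamard[OF F cU[OF W(2)]] by blast
    define W' where "W' = {x \<in> W. snd c x \<in> ball ?p r}"
    have "open W'" unfolding W'_def
      by (rule coordinate_preimage_open[OF smooth_manifold_coordinate_embedding[OF M c(1)] W(1,3) open_UNIV, where F = "\<lambda>y. y"])
         auto
    moreover have "p \<in> W'" using W r by (simp add: W'_def)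
    ultimately have W': "open W'" "p \<in> W'" .
    have gs: "(\<lambda>x. g b (snd c x)) \<in> smooth_funs_at M UNIV p" for b
      by (rule smooth_funs_at_near, rule smooth_function_nearI[OF M c(1) W' _ g])
         (use W(3) in \<open>auto simp: W'_def\<close>)
    \<comment> \<open>The coordinate differences, written as sums so that additivity of the derivation applies verbatim.\<close>
    define k where "k b x = snd c x \<bullet> b + (- (?p \<bullet> b))" for b x
    have ks: "k b \<in> smooth_funs_at M UNIV p" for b
      unfolding k_def[abs_def] by (intro smooth_funs_at_add_mult M cs smooth_funs_at_const)
    have "v (k b) = v (\<lambda>x. snd c x \<bullet> b) + v (\<lambda>x. - (?p \<bullet> b))" for b
      unfolding k_def[abs_def] by (rule tangent_space_add[OF v cs smooth_funs_at_const[OF M]])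
    then have vk: "v (k b) = v (\<lambda>x. snd c x \<bullet> b)" and kp: "k b p = 0" for b
      by (simp_all add: tangent_space_const[OF M v] k_def)
    have kgs: "(\<lambda>x. k b x * g b (snd c x)) \<in> smooth_funs_at M UNIV p" for b
      using smooth_funs_at_add_mult(2)[OF M ks gs] .
    have sum: "(\<lambda>x. \<Sum>b\<in>Basis. k b x * g b (snd c x)) \<in> smooth_funs_at M UNIV p"
        "v (\<lambda>x. \<Sum>b\<in>Basis. k b x * g b (snd c x)) = (\<Sum>b\<in>Basis. v (\<lambda>x. k b x * g b (snd c x)))"
      using tangent_space_sum[OF M v finite_Basis, of "\<lambda>b x. k b x * g b (snd c x)"] kgs by simp_all
    have F'b: "frechet_derivative F (at ?p) = F'" using frechet_derivative_at[OF F'] by simp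
    have fs: "f \<in> smooth_funs_at M UNIV p"
      by (rule smooth_funs_at_near, rule smooth_function_nearI[OF M c(1) W F cU fF])
    have "v f = v (\<lambda>x. F ?p + (\<Sum>b\<in>Basis. k b x * g b (snd c x)))"
      by (rule tangent_space_local[OF M v UNIV_I fs W'])
         (auto simp: W'_def fF Fg k_def inner_diff_left)
    also have "\<dots> = (\<Sum>b\<in>Basis. v (\<lambda>x. k b x * g b (snd c x)))"
      using tangent_space_add[OF v smooth_funs_at_const[OF M] sum(1)] tangent_space_const[OF M v] sum(2) by simp
    also have "\<dots> = (\<Sum>b\<in>Basis. (\<xi> \<bullet> b) * F' b)"
    proof (rule sum.cong)
      fix b :: 'e assume b: "b \<in> Basis"
      have "\<xi> \<bullet> b = v (\<lambda>x. snd c x \<bullet> b)" using b by (simp add: \<xi>_def)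
      then show "v (\<lambda>x. k b x * g b (snd c x)) = (\<xi> \<bullet> b) * F' b"
        using tangent_space_mult[OF v ks gs] vk kp gp F'b by simp
    qed simp
    also have "\<dots> = F' \<xi>" using frechet_derivative_basis_expansion[OF F', of \<xi>] by simp
    finally show "v f = F' \<xi>" .
  qed
qed

text \<open>The velocity at \<open>0\<close> of the straight line through \<open>p\<close> in coordinates, acting on functions.\<close>

definition coordinate_tangent_vector ::
    "('a::topological_space, 'e::euclidean_space) manifold \<Rightarrow> ('a, 'e) chart \<Rightarrow> 'a \<Rightarrow> 'e \<Rightarrow> 'a tangent_vector" where
  "coordinate_tangent_vector M c p \<eta> = (\<lambda>f. if f \<in> smooth_funs_at M UNIV p
     then deriv (\<lambda>t. f (chart_inv c (snd c p + t *\<^sub>R \<eta>))) 0 else 0)"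

lemma coordinate_tangent_vector_apply:
  assumes M: "smooth_manifold M" and c: "c \<in> atlas M" and \<eta>: "\<eta> \<in> model M"
    and f: "f \<in> smooth_funs_at M UNIV p" and W: "open W" "p \<in> W" "W \<subseteq> fst c"
    and F: "\<And>x. x \<in> W \<Longrightarrow> f x = F (snd c x)" "(F has_derivative F') (at (snd c p))"
  shows "coordinate_tangent_vector M c p \<eta> f = F' \<eta>"
proof -
  let ?x = "\<lambda>t::real. snd c p + t *\<^sub>R \<eta>"
  have ch: "is_chart (model M) c" using smooth_manifold_chart[OF M c] .
  have E: "subspace (model M)" using M by (simp add: smooth_manifold_def)
  obtain V where V: "open V" "snd c p \<in> V" "V \<inter> model M \<subseteq> snd c ` W"
    using is_chart_image_nbhd[OF ch W] .
  have x: "(?x has_derivative (\<lambda>t. t *\<^sub>R \<eta>)) (at 0)" by (auto intro!: derivative_eq_intros)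
  have "(F has_derivative F') (at (?x 0))" using F(2) by simp
  from has_derivative_compose[OF x this]
  have D: "((\<lambda>t. F (?x t)) has_real_derivative F' \<eta>) (at 0)"
    unfolding has_field_derivative_def
    by (rule has_derivative_eq_rhs)
       (simp add: fun_eq_iff mult.commute linear_cmul[OF has_derivative_linear[OF F(2)]])
  have eq: "f (chart_inv c (?x t)) = F (?x t)" if "?x t \<in> V" for t
  proof -
    have "snd c p \<in> model M" using is_chart_model[OF ch] W by blast
    then have "?x t \<in> model M" using E \<eta> by (simp add: subspace_add subspace_scale)
    then obtain y where "y \<in> W" "?x t = snd c y" using V(3) \<open>?x t \<in> V\<close> by blast
    then show ?thesis using F(1) chart_inv_left[OF is_chart_inj[OF ch], of y] W(3) by auto
  qed
  have o: "open (?x -` V)" by (rule open_vimage[OF V(1)]) (intro continuous_intros)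
  have "((\<lambda>t. f (chart_inv c (?x t))) has_real_derivative F' \<eta>) (at 0)"
    by (rule has_field_derivative_transform_within_open[OF D o]) (use V(2) eq in auto)
  then show ?thesis using f by (simp add: coordinate_tangent_vector_def DERIV_imp_deriv)
qed

lemma coordinate_tangent_vector_in_tangent_space:
  fixes M :: "('a::{t2_space, second_countable_topology}, 'e::euclidean_space) manifold"
  assumes M: "smooth_manifold M" and c: "c \<in> atlas M" "p \<in> fst c" and \<eta>: "\<eta> \<in> model M"
  shows "coordinate_tangent_vector M c p \<eta> \<in> tangent_space M UNIV p"
proof -
  let ?v = "coordinate_tangent_vector M c p \<eta>"
  have rep: "\<exists>W F F'. open W \<and> p \<in> W \<and> W \<subseteq> fst c \<and> (\<forall>x\<in>W. f x = F (snd c x)) \<and> (F has_derivative F') (at (snd c p))"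
    if f: "f \<in> smooth_funs_at M UNIV p" for f
  proof -
    have "smooth_map_near M real_line f p" using f smooth_funs_at_UNIV_iff[OF M] by blast
    then obtain W U F where W: "open W" "p \<in> W" "W \<subseteq> fst c" "smooth_on_open U F"
      "\<And>x. x \<in> W \<Longrightarrow> snd c x \<in> U" "\<And>x. x \<in> W \<Longrightarrow> f x = F (snd c x)"
      using smooth_function_near_coordinates[OF M c] by blast
    have "C_k_on (Suc 0) U F" using W(4) by (simp only: smooth_on_open_def)
    then have "(F has_derivative frechet_derivative F (at (snd c p))) (at (snd c p))"
      using C_k_on_Suc_derivative W(2,5) by blast
    with W show ?thesis by blast
  qed
  have "?v (\<lambda>x. f x + g x) = ?v f + ?v g \<and> ?v (\<lambda>x. f x * g x) = ?v f * g p + f p * ?v g"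
    if f: "f \<in> smooth_funs_at M UNIV p" and g: "g \<in> smooth_funs_at M UNIV p" for f g
  proof -
    obtain W F F' where W: "open W" "p \<in> W" "W \<subseteq> fst c" "\<forall>x\<in>W. f x = F (snd c x)"
       and F: "(F has_derivative F') (at (snd c p))" using rep[OF f] by blast
    obtain V G G' where V: "open V" "p \<in> V" "V \<subseteq> fst c" "\<forall>x\<in>V. g x = G (snd c x)"
       and G: "(G has_derivative G') (at (snd c p))" using rep[OF g] by blast
    have o: "open (W \<inter> V)" "p \<in> W \<inter> V" "W \<inter> V \<subseteq> fst c" using W V by auto
    note app = coordinate_tangent_vector_apply[OF M c(1) \<eta>]
    have "?v f = F' \<eta>" "?v g = G' \<eta>"
      by (rule app[OF f W(1-3) _ F] app[OF g V(1-3) _ G], use W V in simp)+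
    moreover have "?v (\<lambda>x. f x + g x) = F' \<eta> + G' \<eta>"
      by (rule app[OF smooth_funs_at_add_mult(1)[OF M f g] o _ has_derivative_add[OF F G]]) (use W V in simp)
    moreover have "?v (\<lambda>x. f x * g x) = F (snd c p) * G' \<eta> + F' \<eta> * G (snd c p)"
      by (rule app[OF smooth_funs_at_add_mult(2)[OF M f g] o _ has_derivative_mult[OF F G]]) (use W V in simp)
    ultimately show ?thesis using W(2,4) V(2,4) by simp
  qed
  moreover have "?v (\<lambda>x. a * f x) = a * ?v f" if f: "f \<in> smooth_funs_at M UNIV p" for f a
  proof -
    obtain W F F' where W: "open W" "p \<in> W" "W \<subseteq> fst c" "\<forall>x\<in>W. f x = F (snd c x)"
       and F: "(F has_derivative F') (at (snd c p))" using rep[OF f] by blast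
    note app = coordinate_tangent_vector_apply[OF M c(1) \<eta>]
    have "?v f = F' \<eta>" by (rule app[OF f W(1-3) _ F]) (use W in simp)
    moreover have "?v (\<lambda>x. a * f x) = a * F' \<eta>"
      by (rule app[OF smooth_funs_at_scale[OF M f] W(1-3) _ has_derivative_mult_right[OF F]]) (use W in simp)
    ultimately show ?thesis by simp
  qed
  ultimately show ?thesis
    unfolding tangent_space_def by (simp add: coordinate_tangent_vector_def)
qed

section \<open>Tangent maps\<close>

text \<open>The tangent map into the derivations of a subset \<open>S'\<close>, where the functions to be differentiated
  are those smooth on \<open>S'\<close>; it carries vectors tangent to \<open>N\<close> to vectors tangent to \<open>N'\<close>.\<close>

definition tangent_map_on ::
    "('b::topological_space, 'f::euclidean_space) manifold \<Rightarrow> 'b set \<Rightarrow> ('a \<Rightarrow> 'b) \<Rightarrow> 'a \<Rightarrow>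
     'a tangent_vector \<Rightarrow> 'b tangent_vector" where
  "tangent_map_on M' S' f p v = (\<lambda>\<phi>. if \<phi> \<in> smooth_funs_at M' S' (f p) then v (\<phi> \<circ> f) else 0)"

lemma tangent_map_on_UNIV: "tangent_map_on M' UNIV f p = tangent_map M' f p"
  by (intro ext) (simp add: tangent_map_on_def tangent_map_def)

lemma tangent_map_on_in_tangent_space:
  assumes M: "smooth_manifold M" and M': "smooth_manifold M'" and p: "p \<in> S"
    and v: "v \<in> tangent_space M S p" and f: "smooth_map_at M S M' f p" and S': "\<And>x. x \<in> S \<Longrightarrow> f x \<in> S'"
  shows "tangent_map_on M' S' f p v \<in> tangent_space M' S' (f p)"
proof -
  have comp: "(\<lambda>x. \<phi> (f x)) \<in> smooth_funs_at M S p" if "\<phi> \<in> smooth_funs_at M' S' (f p)" for \<phi>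
    using smooth_funs_at_compose[OF M M' p f that S'] by (simp add: comp_def)
  show ?thesis
    unfolding tangent_space_def tangent_map_on_def
    using tangent_space_add[OF v comp comp] tangent_space_mult[OF v comp comp] tangent_space_scale[OF v comp]
      smooth_funs_at_add_mult[OF M'] smooth_funs_at_scale[OF M']
    by (simp add: comp_def)
qed

lemma push_incl_in_tangent_space:
  assumes "smooth_manifold M" "p \<in> S" "w \<in> tangent_space M S p"
  shows "push_incl M p w \<in> tangent_space M UNIV p"
  unfolding push_incl_def tangent_map_on_UNIV[symmetric]
  by (rule tangent_map_on_in_tangent_space[where S = S and S' = UNIV and f = "\<lambda>x. x", OF assms(1,1-3)])
     (auto intro!: smooth_map_near_imp_at smooth_map_near_id assms)

lemma push_incl_tangent_map_on:
  assumes "smooth_manifold M" "smooth_manifold M'" "p \<in> S" "smooth_map_near M M' f p"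
    "w \<in> tangent_space M S p" "\<And>x. x \<in> S \<Longrightarrow> f x \<in> S'"
  shows "push_incl M' (f p) (tangent_map_on M' S' f p w) = tangent_map M' f p (push_incl M p w)"
proof (rule ext)
  fix \<phi>
  show "push_incl M' (f p) (tangent_map_on M' S' f p w) \<phi> = tangent_map M' f p (push_incl M p w) \<phi>"
  proof (cases "\<phi> \<in> smooth_funs_at M' UNIV (f p)")
    case True
    then have "\<phi> \<in> smooth_funs_at M' S' (f p)"
      using smooth_map_at_subset[of M' UNIV real_line \<phi> "f p" S'] by (simp add: smooth_funs_at_def)
    moreover have "\<phi> \<circ> f \<in> smooth_funs_at M UNIV p"
      using smooth_funs_at_compose[OF assms(1,2) UNIV_I smooth_map_near_imp_at[OF assms(4)] True] by simp
    ultimately show ?thesis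
      using True by (simp add: push_incl_def tangent_map_def tangent_map_on_def comp_def)
  next
    case False
    then show ?thesis by (simp add: push_incl_def tangent_map_def)
  qed
qed

text \<open>A smooth function on \<open>S\<close> extends near \<open>p\<close> to the ambient manifold, and a derivation does not see the change
  away from \<open>p\<close>.  So a tangent vector of \<open>S\<close> is determined by its image in the ambient tangent space.\<close>

lemma push_incl_inject:
  assumes M: "smooth_manifold M" and p: "p \<in> S"
    and w: "w \<in> tangent_space M S p" "w' \<in> tangent_space M S p"
    and eq: "push_incl M p w = push_incl M p w'"
  shows "w = w'"
proof (rule ext)
  fix f
  show "w f = w' f"
  proof (cases "f \<in> smooth_funs_at M S p")
    case True
    then obtain W F where W: "open W" "p \<in> W" "smooth_map_near M real_line F p" "\<And>x. x \<in> W \<inter> S \<Longrightarrow> f x = F x"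
      using smooth_funs_atE[OF True] by blast
    have F: "F \<in> smooth_funs_at M UNIV p" using W(3) by (rule smooth_funs_at_near)
    have "w f = w F" "w' f = w' F"
      using tangent_space_local[OF M w(1) p True W(1,2,4)] tangent_space_local[OF M w(2) p True W(1,2,4)] by auto
    moreover have "w F = push_incl M p w F" "w' F = push_incl M p w' F"
      using F by (simp_all add: push_incl_def tangent_map_def comp_def)
    ultimately show ?thesis using eq by simp
  next
    case False
    then show ?thesis using tangent_space_nonsmooth w by metis
  qed
qed

lemma pull_incl_push_incl:
  assumes "smooth_manifold M" "p \<in> S" "w \<in> tangent_space M S p"
  shows "pull_incl M S p (push_incl M p w) = w"
  unfolding pull_incl_def using assms push_incl_inject[OF assms(1,2)] by (intro the_equality) auto


section \<open>Tangent vectors of the fibres of a submersion\<close>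

text \<open>A first-order form of the implicit function theorem: every kernel vector is the velocity of a curve in the
  level set.  With \<open>T\<close> a linear right inverse of \<open>A\<close> whose range lies in \<open>E\<close>, the map
  \<open>H x = x + T (a x - a p - A (x - p))\<close> has derivative the identity at \<open>p\<close>, and the curve is the local inverse
  of \<open>H\<close> applied to the line \<open>p + t \<xi>\<close>.  It stays in \<open>E\<close> because \<open>H\<close> only moves points by vectors of \<open>E\<close>,
  and applying \<open>A\<close> to \<open>H (x t) = p + t \<xi>\<close> shows that \<open>a\<close> is constant along it.  This uses that \<open>T\<close> inverts \<open>A\<close> on
  \<open>a x - a p - A (x - p)\<close>, which holds as long as \<open>a x\<close> stays in \<open>F\<close>.\<close>

lemma curve_in_level_set:
  fixes a :: "'e::euclidean_space \<Rightarrow> 'f::euclidean_space"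
  assumes a: "C_k_on (Suc 0) U a" "open U" "p \<in> U" and A: "(a has_derivative A) (at p)"
    and E: "subspace E" "p \<in> E" and F: "subspace F" "F \<subseteq> A ` E" "a p \<in> F"
    and \<xi>: "\<xi> \<in> E" "A \<xi> = 0"
  obtains x :: "real \<Rightarrow> 'e" where "x 0 = p" "(x has_vector_derivative \<xi>) (at 0)"
    "\<forall>\<^sub>F t in nhds 0. x t \<in> U \<inter> E \<and> (a (x t) \<in> F \<longrightarrow> a (x t) = a p)"
proof -
  have lA: "linear A" using A has_derivative_linear by blast
  obtain T where T: "range T \<subseteq> E" "linear T" "\<And>z. z \<in> A ` E \<Longrightarrow> A (T z) = z"
    using linear_exists_right_inverse_on[OF lA E(1)] by blast
  have sA: "subspace (A ` E)" using lA E(1) linear_subspace_image by blast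
  let ?D = "\<lambda>x. Blinfun (frechet_derivative a (at x))"
  have D: "(a has_derivative blinfun_apply (?D x)) (at x)" if "x \<in> U" for x
  proof -
    have "(a has_derivative frechet_derivative a (at x)) (at x)" using C_k_on_Suc_derivative[OF a(1) that] .
    then show ?thesis by (simp add: bounded_linear_Blinfun_apply[OF has_derivative_bounded_linear])
  qed
  have Dp: "blinfun_apply (?D p) = A" using has_derivative_unique[OF D[OF a(3)] A] .
  have bT: "blinfun_apply (Blinfun T) = T"
    using T(2) by (simp add: bounded_linear_Blinfun_apply linear_conv_bounded_linear)
  \<comment> \<open>Adding the nonlinear part of \<open>a\<close>, pulled back by \<open>T\<close>, straightens the level set of \<open>a\<close> through \<open>p\<close>.\<close>
  define H where "H x = x + T (a x - a p - A (x - p))" for x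
  define H' where "H' x = id_blinfun + (Blinfun T o\<^sub>L (?D x - ?D p))" for x
  have Hp: "H p = p" using linear_0[OF lA] linear_0[OF T(2)] by (simp add: H_def)
  have H'p: "H' p = id_blinfun" by (simp add: H'_def)
  have dH: "(H has_derivative blinfun_apply (H' x)) (at x)" if "x \<in> U" for x
  proof -
    have "((\<lambda>x. a x - a p - A (x - p)) has_derivative (\<lambda>h. ?D x h - A h)) (at x)"
    proof -
      have "((\<lambda>x. x - p) has_derivative (\<lambda>h. h)) (at x)" by (auto intro!: derivative_eq_intros)
      then have "((\<lambda>x. A (x - p)) has_derivative A) (at x)"
        by (rule bounded_linear.has_derivative[OF has_derivative_bounded_linear[OF A]])
      then show ?thesis using D[OF that] by (auto intro!: derivative_eq_intros)
    qed
    moreover have "bounded_linear T" using T(2) by (simp add: linear_conv_bounded_linear)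
    ultimately have "((\<lambda>x. T (a x - a p - A (x - p))) has_derivative (\<lambda>h. T (?D x h - A h))) (at x)"
      by (rule bounded_linear.has_derivative[rotated])
    then have "(H has_derivative (\<lambda>h. h + T (?D x h - A h))) (at x)"
      unfolding H_def[abs_def] by (rule has_derivative_add[OF has_derivative_ident])
    then show ?thesis
      by (rule has_derivative_eq_rhs)
         (simp add: H'_def fun_eq_iff blinfun.add_left blinfun.diff_left bT Dp)
  qed
  have cH: "continuous_on U H'"
    unfolding H'_def[abs_def]
    by (intro continuous_intros continuous_on_blinfun_derivative[OF a(1)])
  have inv: "id_blinfun o\<^sub>L H' p = id_blinfun" by (simp add: H'p blinfun_eqI)
  obtain U' V g g' where g: "open U'" "U' \<subseteq> U" "p \<in> U'" "open V" "H p \<in> V" "homeomorphism U' V H g"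
    "\<And>y. y \<in> V \<Longrightarrow> (g has_derivative (g' y)) (at y)"
    "\<And>y. y \<in> V \<Longrightarrow> g' y = inv (blinfun_apply (H' (g y)))"
    by (rule inverse_function_theorem[OF a(2) dH cH a(3) inv], assumption, rule that)
  have pV: "p \<in> V" using g(5) Hp by simp
  have gp: "g p = p" using homeomorphism_apply1[OF g(6,3)] Hp by simp
  have "g' p = (\<lambda>h. h)"
    using g(8)[OF pV] gp H'p by (simp add: inv_id[unfolded id_def] id_def)
  then have dg: "(g has_derivative (\<lambda>h. h)) (at p)" using g(7)[OF pV] by simp
  define x where "x t = g (p + t *\<^sub>R \<xi>)" for t :: real
  show ?thesis
  proof (rule that)
    show "x 0 = p" by (simp add: x_def gp)
    have l: "((\<lambda>t. p + t *\<^sub>R \<xi>) has_derivative (\<lambda>t. t *\<^sub>R \<xi>)) (at (0::real))"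
      by (auto intro!: derivative_eq_intros)
    have "(g has_derivative (\<lambda>h. h)) (at (p + 0 *\<^sub>R \<xi>))" using dg by simp
    from has_derivative_compose[OF l this] show "(x has_vector_derivative \<xi>) (at 0)"
      by (simp add: has_vector_derivative_def x_def[abs_def])
    have "open ((\<lambda>t::real. p + t *\<^sub>R \<xi>) -` V)"
      by (rule open_vimage[OF g(4)]) (intro continuous_intros)
    then have "\<forall>\<^sub>F t in nhds (0::real). p + t *\<^sub>R \<xi> \<in> V"
      unfolding eventually_nhds using pV by (intro exI[of _ "(\<lambda>t::real. p + t *\<^sub>R \<xi>) -` V"]) auto
    then show "\<forall>\<^sub>F t in nhds 0. x t \<in> U \<inter> E \<and> (a (x t) \<in> F \<longrightarrow> a (x t) = a p)"
    proof (rule eventually_mono)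
      fix t :: real assume t: "p + t *\<^sub>R \<xi> \<in> V"
      let ?z = "a (x t) - a p - A (x t - p)"
      have "x t \<in> U'" using homeomorphism_image2[OF g(6)] t by (auto simp: x_def)
      have Hx: "x t + T ?z = p + t *\<^sub>R \<xi>"
        using homeomorphism_apply2[OF g(6) t] by (simp add: x_def[symmetric] H_def)
      have "x t = p + t *\<^sub>R \<xi> - T ?z" using Hx by (simp add: algebra_simps)
      moreover have "p + t *\<^sub>R \<xi> - T ?z \<in> E"
        using E \<xi>(1) T(1) by (intro subspace_diff subspace_add subspace_scale) auto
      ultimately have xE: "x t \<in> E" by simp
      moreover have "a (x t) = a p" if "a (x t) \<in> F"
      proof -
        have "x t - p \<in> E" using subspace_diff[OF E(1) xE E(2)] .
        then have "A (x t - p) \<in> A ` E" by blast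
        moreover have "a (x t) - a p \<in> A ` E" using subspace_diff[OF F(1) that F(3)] F(2) by blast
        ultimately have "A (T ?z) = ?z" using subspace_diff[OF sA] T(3) by blast
        moreover have "A (x t) + A (T ?z) = A p + t *\<^sub>R A \<xi>"
          using arg_cong[OF Hx, of A] by (simp add: linear_add[OF lA] linear_cmul[OF lA])
        ultimately show ?thesis using \<xi>(2) by (simp add: linear_diff[OF lA])
      qed
      ultimately show "x t \<in> U \<inter> E \<and> (a (x t) \<in> F \<longrightarrow> a (x t) = a p)"
        using \<open>x t \<in> U'\<close> g(2) by blast
    qed
  qed
qed

text \<open>In coordinates \<open>v\<close> is the velocity of a curve in the fibre of \<open>a\<close> through \<open>p\<close>, and \<open>f\<close> vanishes along that
  curve.  Surjectivity of the tangent map on derivations gives surjectivity of the derivative on coordinate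
  vectors, because every coordinate vector of \<open>Q\<close> is realised by a derivation.\<close>

lemma kernel_annihilates_functions_vanishing_on_fibre:
  fixes M :: "('a::{t2_space, second_countable_topology}, 'e::euclidean_space) manifold"
    and Q :: "('b::{t2_space, second_countable_topology}, 'f::euclidean_space) manifold"
  assumes M: "smooth_manifold M" and Q: "smooth_manifold Q" and a: "submersion M Q a"
    and v: "v \<in> tangent_space M UNIV p" "tangent_map Q a p v = (\<lambda>\<phi>. 0)"
    and f: "smooth_map_near M real_line f p" and W0: "open W0" "p \<in> W0"
    and f0: "\<And>x. x \<in> W0 \<Longrightarrow> a x = a p \<Longrightarrow> f x = 0"
  shows "v f = 0"
proof -
  obtain c where c: "c \<in> atlas M" "p \<in> fst c" using smooth_manifold_chart_at[OF M] .
  obtain d where d: "d \<in> atlas Q" "a p \<in> fst d" using smooth_manifold_chart_at[OF Q] .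
  have ch: "is_chart (model M) c" using smooth_manifold_chart[OF M c(1)] .
  have dh: "is_chart (model Q) d" using smooth_manifold_chart[OF Q d(1)] .
  have od: "open (fst d)" using dh by (simp add: is_chart_def)
  have sE: "subspace (model M)" "subspace (model Q)" using M Q by (auto simp: smooth_manifold_def)
  have "smooth_map_near M Q a p"
    using a smooth_map_at_UNIV_iff[OF M] by (auto simp: submersion_def smooth_map_on_def)
  then have "smooth_via c d a p" using smooth_map_near_smooth_via[where f = a and p = p, OF M Q _ c d] by blast
  then obtain W1 U ah where W1: "open W1" "p \<in> W1" "W1 \<subseteq> fst c" "\<And>x. x \<in> W1 \<Longrightarrow> a x \<in> fst d"
     "smooth_on_open U ah" "\<And>x. x \<in> W1 \<Longrightarrow> snd c x \<in> U" "\<And>x. x \<in> W1 \<Longrightarrow> snd d (a x) = ah (snd c x)"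
    unfolding smooth_via_def by (auto simp: image_subset_iff)
  obtain W2 U2 fh where W2: "open W2" "p \<in> W2" "W2 \<subseteq> fst c" "smooth_on_open U2 fh"
    "\<And>x. x \<in> W2 \<Longrightarrow> snd c x \<in> U2" "\<And>x. x \<in> W2 \<Longrightarrow> f x = fh (snd c x)"
    using smooth_function_near_coordinates[OF M c f] by blast
  let ?p = "snd c p"
  have C1: "C_k_on (Suc 0) U ah" "open U" "C_k_on (Suc 0) U2 fh"
    using W1(5) W2(4) by (simp_all only: smooth_on_open_def)
  define A where "A = frechet_derivative ah (at ?p)"
  have A: "(ah has_derivative A) (at ?p)"
    unfolding A_def using C_k_on_Suc_derivative[OF C1(1) W1(6)[OF W1(2)]] .
  define B where "B = frechet_derivative fh (at ?p)"
  have B: "(fh has_derivative B) (at ?p)"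
    unfolding B_def using C_k_on_Suc_derivative[OF C1(3) W2(5)[OF W2(2)]] .
  have push: "\<exists>\<xi>\<in>model M. (\<forall>b. tangent_map Q a p w (\<lambda>y. snd d y \<bullet> b) = A \<xi> \<bullet> b) \<and> w f = B \<xi>"
    if w: "w \<in> tangent_space M UNIV p" for w
  proof -
    obtain \<xi> where \<xi>: "\<xi> \<in> model M"
      "\<And>f W U F F'. open W \<Longrightarrow> p \<in> W \<Longrightarrow> W \<subseteq> fst c \<Longrightarrow> smooth_on_open U F \<Longrightarrow>
       (\<And>x. x \<in> W \<Longrightarrow> snd c x \<in> U) \<Longrightarrow> (\<And>x. x \<in> W \<Longrightarrow> f x = F (snd c x)) \<Longrightarrow>
       (F has_derivative F') (at (snd c p)) \<Longrightarrow> w f = F' \<xi>"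
      using tangent_vector_coordinates[OF M w c] by blast
    have "tangent_map Q a p w (\<lambda>y. snd d y \<bullet> b) = A \<xi> \<bullet> b" for b
    proof -
      have "(\<lambda>y. snd d y \<bullet> b) \<in> smooth_funs_at Q UNIV (a p)"
        using coordinate_function_smooth[OF Q d] by (rule smooth_funs_at_near)
      then have "tangent_map Q a p w (\<lambda>y. snd d y \<bullet> b) = w (\<lambda>x. snd d (a x) \<bullet> b)"
        by (simp add: tangent_map_def comp_def)
      also have "\<dots> = A \<xi> \<bullet> b"
      proof (rule \<xi>(2)[OF W1(1-3)])
        show "smooth_on_open U (\<lambda>y. ah y \<bullet> b)"
          using W1(5) C_k_on_linear_compose[OF bounded_linear_inner_left[of b]]
          unfolding smooth_on_open_def by blast
        show "((\<lambda>y. ah y \<bullet> b) has_derivative (\<lambda>h. A h \<bullet> b)) (at ?p)"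
          by (rule has_derivative_inner_left[OF A])
      qed (use W1(6,7) in auto)
      finally show ?thesis .
    qed
    moreover have "w f = B \<xi>" by (rule \<xi>(2)[OF W2 B])
    ultimately show ?thesis using \<xi>(1) by blast
  qed
  obtain \<xi> where \<xi>: "\<xi> \<in> model M" "\<And>b. tangent_map Q a p v (\<lambda>y. snd d y \<bullet> b) = A \<xi> \<bullet> b" "v f = B \<xi>"
    using push[OF v(1)] by blast
  have A\<xi>: "A \<xi> = 0"
    using \<xi>(2) v(2) by (metis inner_eq_zero_iff)
  \<comment> \<open>The submersion hypothesis speaks of derivations; testing on coordinate functions turns it into linear algebra.\<close>
  have onto: "model Q \<subseteq> A ` model M"
  proof
    fix \<eta> assume \<eta>: "\<eta> \<in> model Q"
    let ?w = "coordinate_tangent_vector Q d (a p) \<eta>"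
    have "?w \<in> tangent_space Q UNIV (a p)"
      by (rule coordinate_tangent_vector_in_tangent_space[OF Q d \<eta>])
    then have "?w \<in> tangent_map Q a p ` tangent_space M UNIV p"
      using a by (simp add: submersion_def)
    then obtain u where u: "u \<in> tangent_space M UNIV p" "tangent_map Q a p u = ?w"
      by (auto simp: image_iff)
    obtain \<zeta> where \<zeta>: "\<zeta> \<in> model M" "\<And>b. ?w (\<lambda>y. snd d y \<bullet> b) = A \<zeta> \<bullet> b"
      using push[OF u(1)] u(2) by auto
    have "?w (\<lambda>y. snd d y \<bullet> b) = \<eta> \<bullet> b" for b
      by (rule coordinate_tangent_vector_apply[OF Q d(1) \<eta> _ od d(2), where F = "\<lambda>z. z \<bullet> b"])
         (auto intro: smooth_funs_at_near coordinate_function_smooth[OF Q d] has_derivative_inner_left)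
    then have "\<eta> \<bullet> b = A \<zeta> \<bullet> b" for b using \<zeta>(2) by simp
    then have "\<eta> = A \<zeta>" by (rule euclidean_eqI)
    then show "\<eta> \<in> A ` model M" using \<zeta>(1) by blast
  qed
  have pE: "?p \<in> model M" using is_chart_model[OF ch c(2)] .
  have ahp: "ah ?p = snd d (a p)" using W1(2,7) by simp
  then have "ah ?p \<in> model Q" using is_chart_model[OF dh d(2)] by simp
  then obtain x where x: "x 0 = ?p" "(x has_vector_derivative \<xi>) (at 0)"
    "\<forall>\<^sub>F t in nhds 0. x t \<in> U \<inter> model M \<and> (ah (x t) \<in> model Q \<longrightarrow> ah (x t) = ah ?p)"
    using curve_in_level_set[OF C1(1,2) W1(6)[OF W1(2)] A sE(1) pE sE(2) onto _ \<xi>(1) A\<xi>] by blast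
  let ?W = "W0 \<inter> W1 \<inter> W2"
  obtain V where V: "open V" "?p \<in> V" "V \<inter> model M \<subseteq> snd c ` ?W"
    using is_chart_image_nbhd[OF ch, of ?W p] W0 W1(1-3) W2(1,2) by blast
  have "continuous (at 0) x" using x(2) has_vector_derivative_continuous by blast
  then have "(x \<longlongrightarrow> x 0) (nhds 0)"
    unfolding continuous_at tendsto_at_iff_tendsto_nhds .
  then have "(x \<longlongrightarrow> ?p) (nhds 0)" by (simp only: x(1))
  then have "\<forall>\<^sub>F t in nhds 0. x t \<in> V" using V(1,2) topological_tendstoD by blast
  with x(3) have zero: "\<forall>\<^sub>F t in nhds 0. fh (x t) = 0"
  proof (rule eventually_elim2)
    fix t assume t: "x t \<in> U \<inter> model M \<and> (ah (x t) \<in> model Q \<longrightarrow> ah (x t) = ah ?p)" and "x t \<in> V"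
    then obtain y where y: "y \<in> ?W" "x t = snd c y" using V(3) by blast
    then have ay: "a y \<in> fst d" "snd d (a y) = ah (x t)" using W1(4,7) by auto
    then have "ah (x t) \<in> model Q" using is_chart_model[OF dh ay(1)] by simp
    then have "snd d (a y) = snd d (a p)" using t ay(2) ahp by simp
    then have "a y = a p" using inj_onD[OF is_chart_inj[OF dh] _ ay(1) d(2)] by blast
    then have "f y = 0" using f0 y(1) by blast
    then show "fh (x t) = 0" using W2(6)[of y] y by simp
  qed
  have ev: "\<forall>\<^sub>F t in at 0. fh (x t) = 0"
    using zero unfolding eventually_at_filter by (rule eventually_mono) simp
  have ev0: "fh (x 0) = 0" by (rule eventually_nhds_x_imp_x[OF zero])
  have "((\<lambda>t. fh (x t)) has_derivative (\<lambda>t. B (t *\<^sub>R \<xi>))) (at 0)"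
    by (rule has_derivative_compose[where g = fh and f = x])
       (use x(1,2) B in \<open>simp_all add: has_vector_derivative_def\<close>)
  then have "((\<lambda>t::real. 0::real) has_derivative (\<lambda>t. B (t *\<^sub>R \<xi>))) (at 0)"
    by (rule has_derivative_transform_eventually[OF _ ev ev0]) simp
  then have "(\<lambda>t. B (t *\<^sub>R \<xi>)) = (\<lambda>t::real. 0)"
    using has_derivative_unique has_derivative_const by blast
  from fun_cong[OF this, of 1] show ?thesis using \<xi>(3) by simp
qed

text \<open>A function on the fibre is differentiated along \<open>v\<close> by extending it to the ambient manifold.  Two extensions
  differ by a function that vanishes on the fibre, which \<open>v\<close> annihilates, so the result does not depend on the
  choice.\<close>

lemma kernel_vector_tangent_to_fibre:
  fixes M :: "('a::{t2_space, second_countable_topology}, 'e::euclidean_space) manifold"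
    and Q :: "('b::{t2_space, second_countable_topology}, 'f::euclidean_space) manifold"
  assumes M: "smooth_manifold M" and Q: "smooth_manifold Q" and a: "submersion M Q a"
    and v: "v \<in> tangent_space M UNIV p" "tangent_map Q a p v = (\<lambda>\<phi>. 0)"
    and S: "S = {x. a x = a p}"
  obtains w where "w \<in> tangent_space M S p" "push_incl M p w = v"
proof -
  \<comment> \<open>\<open>ext f F\<close>: the ambient smooth function \<open>F\<close> extends the germ at \<open>p\<close> of \<open>f\<close> on the fibre.\<close>
  define ext where "ext f F \<longleftrightarrow> smooth_map_near M real_line F p \<and>
     (\<exists>W. open W \<and> p \<in> W \<and> (\<forall>x\<in>W \<inter> S. f x = F x))" for f F
  have unique: "v F = v F'" if e: "ext f F" "ext f F'" for f F F'
  proof -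
    obtain W where W: "open W" "p \<in> W" "\<forall>x\<in>W \<inter> S. f x = F x"
      using e(1) unfolding ext_def by blast
    obtain W' where W': "open W'" "p \<in> W'" "\<forall>x\<in>W' \<inter> S. f x = F' x"
      using e(2) unfolding ext_def by blast
    have F: "smooth_map_near M real_line F p" "smooth_map_near M real_line F' p"
      using e by (auto simp: ext_def)
    then have neg: "smooth_map_near M real_line (\<lambda>x. (- 1) * F' x) p"
      using smooth_function_near_scale[OF M] by blast
    have "v (\<lambda>x. F x + (- 1) * F' x) = 0"
    proof (rule kernel_annihilates_functions_vanishing_on_fibre[OF M Q a v smooth_function_near_add[OF M F(1) neg]])
      show "open (W \<inter> W')" "p \<in> W \<inter> W'" using W W' by auto
      show "F x + (- 1) * F' x = 0" if "x \<in> W \<inter> W'" "a x = a p" for x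
      proof -
        have "x \<in> S" using that(2) S by simp
        then have "f x = F x" "f x = F' x" using that(1) W(3) W'(3) by blast+
        then show ?thesis by simp
      qed
    qed
    moreover have "v (\<lambda>x. F x + (- 1) * F' x) = v F + (- 1) * v F'"
      using tangent_space_add[OF v(1) smooth_funs_at_near[OF F(1)] smooth_funs_at_near[OF neg]]
        tangent_space_scale[OF v(1) smooth_funs_at_near[OF F(2)], of "- 1"] by simp
    ultimately show ?thesis by simp
  qed
  define w where "w f = (if f \<in> smooth_funs_at M S p then v (SOME F. ext f F) else 0)" for f
  have ex: "\<exists>F. ext f F" if f: "f \<in> smooth_funs_at M S p" for f
  proof -
    obtain W F where "open W" "p \<in> W" "smooth_map_near M real_line F p" "\<And>x. x \<in> W \<inter> S \<Longrightarrow> f x = F x"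
      using smooth_funs_atE[OF f] by blast
    then show ?thesis unfolding ext_def by blast
  qed
  have w_eq: "w f = v F" if "ext f F" for f F
  proof -
    have "f \<in> smooth_funs_at M S p" using that smooth_funs_atI[of _ p M F S f] unfolding ext_def by blast
    moreover have "v (SOME F. ext f F) = v F" by (rule unique[OF someI[of "ext f", OF that] that])
    ultimately show ?thesis by (simp add: w_def)
  qed
  have "w \<in> tangent_space M S p"
  proof -
    have "w (\<lambda>x. f x + g x) = w f + w g \<and> w (\<lambda>x. f x * g x) = w f * g p + f p * w g"
      if f: "f \<in> smooth_funs_at M S p" and g: "g \<in> smooth_funs_at M S p" for f g
    proof -
      obtain F where F: "ext f F" using ex[OF f] by blast
      obtain G where G: "ext g G" using ex[OF g] by blast
      obtain W where W: "open W" "p \<in> W" "\<forall>x\<in>W \<inter> S. f x = F x"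
        using F unfolding ext_def by blast
      obtain W' where W': "open W'" "p \<in> W'" "\<forall>x\<in>W' \<inter> S. g x = G x"
        using G unfolding ext_def by blast
      have sm: "smooth_map_near M real_line F p" "smooth_map_near M real_line G p"
        using F G by (auto simp: ext_def)
      have o: "open (W \<inter> W')" "p \<in> W \<inter> W'" using W W' by auto
      have "ext (\<lambda>x. f x + g x) (\<lambda>x. F x + G x)"
        unfolding ext_def
      proof (intro conjI exI[of _ "W \<inter> W'"] o)
        show "smooth_map_near M real_line (\<lambda>x. F x + G x) p" by (rule smooth_function_near_add[OF M sm])
      qed (use W(3) W'(3) in simp)
      moreover have "ext (\<lambda>x. f x * g x) (\<lambda>x. F x * G x)"
        unfolding ext_def
      proof (intro conjI exI[of _ "W \<inter> W'"] o)
        show "smooth_map_near M real_line (\<lambda>x. F x * G x) p" by (rule smooth_function_near_mult[OF M sm])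
      qed (use W(3) W'(3) in simp)
      moreover have "f p = F p" "g p = G p" using W(2,3) W'(2,3) S by auto
      ultimately show ?thesis
        using w_eq[OF F] w_eq[OF G] w_eq tangent_space_add[OF v(1) smooth_funs_at_near[OF sm(1)] smooth_funs_at_near[OF sm(2)]]
          tangent_space_mult[OF v(1) smooth_funs_at_near[OF sm(1)] smooth_funs_at_near[OF sm(2)]] by simp
    qed
    moreover have "w (\<lambda>x. k * f x) = k * w f" if f: "f \<in> smooth_funs_at M S p" for f k
    proof -
      obtain F where F: "ext f F" using ex[OF f] by blast
      then have sm: "smooth_map_near M real_line F p" by (simp add: ext_def)
      have "ext (\<lambda>x. k * f x) (\<lambda>x. k * F x)"
        using F smooth_function_near_scale[OF M sm, of k] by (auto simp: ext_def)
      then show ?thesis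
        using w_eq[OF F] w_eq tangent_space_scale[OF v(1) smooth_funs_at_near[OF sm], of k] by simp
    qed
    ultimately show ?thesis unfolding tangent_space_def by (simp add: w_def)
  qed
  moreover have "push_incl M p w = v"
  proof (rule ext)
    fix f
    show "push_incl M p w f = v f"
    proof (cases "f \<in> smooth_funs_at M UNIV p")
      case True
      then have "ext f f" using smooth_funs_at_UNIV_iff[OF M] unfolding ext_def by blast
      then show ?thesis using True w_eq by (simp add: push_incl_def tangent_map_def comp_def)
    next
      case False
      then show ?thesis using tangent_space_nonsmooth[OF v(1)] by (simp add: push_incl_def tangent_map_def)
    qed
  qed
  ultimately show ?thesis by (rule that)
qed

section \<open>Translations along the source fibres\<close>

lemma tangent_space_lincomb:
  assumes "smooth_manifold M" "v \<in> tangent_space M S p" "w \<in> tangent_space M S p"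
  shows "(\<lambda>f. a * v f + b * w f) \<in> tangent_space M S p"
  using assms(2,3) unfolding tangent_space_def by (auto simp: algebra_simps)

lemma dual_space_add: "\<mu> \<in> dual_space V \<Longrightarrow> v \<in> V \<Longrightarrow> w \<in> V \<Longrightarrow> \<mu> (\<lambda>f. v f + w f) = \<mu> v + \<mu> w"
  by (simp add: dual_space_def)

lemma dual_space_scale: "\<mu> \<in> dual_space V \<Longrightarrow> v \<in> V \<Longrightarrow> \<mu> (\<lambda>f. k * v f) = k * \<mu> v"
  by (simp add: dual_space_def)

text \<open>A map \<open>\<tau>\<close> that is defined, or at least smooth, only along the fibre \<open>S\<close> of a submersion \<open>a\<close> through \<open>p\<close>,
  together with its effect on the kernel of the tangent map of \<open>a\<close>.  The left translation \<open>\<ell>\<^sub>g\<close> and the map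
  \<open>r\<^sub>g \<circ> i\<close> of a Lie groupoid are the two instances of interest; they share the proofs of linearity and
  naturality.\<close>

locale fibre_translation =
  fixes M :: "('a::{t2_space, second_countable_topology}, 'e::euclidean_space) manifold"
    and Q :: "('b::{t2_space, second_countable_topology}, 'f::euclidean_space) manifold"
    and a :: "'a \<Rightarrow> 'b" and p :: 'a and S :: "'a set" and \<tau> :: "'a \<Rightarrow> 'a"
  assumes M: "smooth_manifold M" and Q: "smooth_manifold Q" and a: "submersion M Q a"
    and S: "S = {x. a x = a p}" and \<tau>: "smooth_map_at M S M \<tau> p"
begin

definition kern where "kern = {v \<in> tangent_space M UNIV p. tangent_map Q a p v = (\<lambda>\<phi>. 0)}"

definition translate where "translate v = tangent_map M \<tau> p (pull_incl M S p v)"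

lemma p_in_fibre: "p \<in> S"
  by (simp add: S)

lemma pull_incl_kern:
  assumes "v \<in> kern"
  shows "pull_incl M S p v \<in> tangent_space M S p" "push_incl M p (pull_incl M S p v) = v"
proof -
  obtain w where "w \<in> tangent_space M S p" "push_incl M p w = v"
    using kernel_vector_tangent_to_fibre[OF M Q a _ _ S] assms unfolding kern_def by blast
  then show "pull_incl M S p v \<in> tangent_space M S p" "push_incl M p (pull_incl M S p v) = v"
    using pull_incl_push_incl[OF M p_in_fibre] by auto
qed

lemma pull_incl_lincomb:
  assumes "v \<in> kern" "w \<in> kern"
  shows "pull_incl M S p (\<lambda>f. k * v f + l * w f) = (\<lambda>f. k * pull_incl M S p v f + l * pull_incl M S p w f)"
    (is "_ = ?u")
proof -
  have "?u \<in> tangent_space M S p"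
    using tangent_space_lincomb[OF M] pull_incl_kern(1) assms by blast
  moreover have "push_incl M p ?u = (\<lambda>f. k * push_incl M p (pull_incl M S p v) f + l * push_incl M p (pull_incl M S p w) f)"
    by (auto simp: push_incl_def tangent_map_def)
  ultimately show ?thesis
    using pull_incl_push_incl[OF M p_in_fibre, of ?u] pull_incl_kern(2) assms by simp
qed

lemma translate_lincomb:
  assumes "v \<in> kern" "w \<in> kern"
  shows "translate (\<lambda>f. k * v f + l * w f) = (\<lambda>f. k * translate v f + l * translate w f)"
  unfolding translate_def pull_incl_lincomb[OF assms] by (auto simp: tangent_map_def)

lemma translate_in_tangent_space:
  assumes "v \<in> kern"
  shows "translate v \<in> tangent_space M UNIV (\<tau> p)"
  unfolding translate_def tangent_map_on_UNIV[symmetric]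
  by (rule tangent_map_on_in_tangent_space[OF M M p_in_fibre pull_incl_kern(1)[OF assms] \<tau>]) simp

text \<open>The factor \<open>k\<close> accommodates the sign in the definition of right-invariant vector fields: \<open>k\<close> is \<open>-1\<close> for the
  source of a covector and \<open>1\<close> for its target.\<close>

lemma translate_dual:
  assumes \<mu>: "\<mu> \<in> dual_space (tangent_space M UNIV (\<tau> p))"
  shows "(\<lambda>v. if v \<in> kern then \<mu> (\<lambda>f. k * translate v f) else 0) \<in> dual_space kern"
proof -
  have kern: "(\<lambda>f. r * v f + s * w f) \<in> kern" if "v \<in> kern" "w \<in> kern" for v w r s
  proof -
    have "tangent_map Q a p (\<lambda>f. r * v f + s * w f)
        = (\<lambda>f. r * tangent_map Q a p v f + s * tangent_map Q a p w f)"
      by (auto simp: tangent_map_def)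
    then show ?thesis using that tangent_space_lincomb[OF M] by (simp add: kern_def)
  qed
  have lin: "\<mu> (\<lambda>f. k * translate (\<lambda>f. r * v f + s * w f) f) = r * \<mu> (\<lambda>f. k * translate v f) + s * \<mu> (\<lambda>f. k * translate w f)"
    if "v \<in> kern" "w \<in> kern" for v w r s
  proof -
    let ?T = "tangent_space M UNIV (\<tau> p)"
    have T: "(\<lambda>f. c * u f) \<in> ?T" if "u \<in> ?T" for u c
      using tangent_space_lincomb[OF M that that, of c 0] by simp
    have v: "(\<lambda>f. k * translate v f) \<in> ?T" "(\<lambda>f. k * translate w f) \<in> ?T"
      using T translate_in_tangent_space that by blast+
    have "(\<lambda>f. k * translate (\<lambda>f. r * v f + s * w f) f)
        = (\<lambda>f. r * (k * translate v f) + s * (k * translate w f))"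
      using translate_lincomb[OF that] by (auto simp: algebra_simps)
    then have "\<mu> (\<lambda>f. k * translate (\<lambda>f. r * v f + s * w f) f)
        = \<mu> (\<lambda>f. r * (k * translate v f) + s * (k * translate w f))"
      by (rule arg_cong)
    also have "\<dots> = \<mu> (\<lambda>f. r * (k * translate v f)) + \<mu> (\<lambda>f. s * (k * translate w f))"
      by (rule dual_space_add[OF \<mu> T[OF v(1), of r] T[OF v(2), of s]])
    also have "\<dots> = r * \<mu> (\<lambda>f. k * translate v f) + s * \<mu> (\<lambda>f. k * translate w f)"
      using dual_space_scale[OF \<mu> v(1)] dual_space_scale[OF \<mu> v(2)] by simp
    finally show ?thesis .
  qed
  show ?thesis
    unfolding dual_space_def
    using kern[of _ _ 1 1] lin[of _ _ 1 1] kern[of v v r 0 for v r] lin[of v v r 0 for v r] by simp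
qed

end

text \<open>Since a tangent vector of the fibre is determined by its image in the ambient tangent space, the tangent map of
  \<open>\<Phi>\<close> commutes with regarding kernel vectors as tangent to the fibres.  What remains is the chain rule for
  \<open>\<Phi> \<circ> \<tau> = \<tau>' \<circ> \<Phi>\<close>, an identity which holds on the fibre only; that suffices because derivations at a point
  of \<open>S\<close> see functions on \<open>S\<close> only.\<close>

lemma translate_natural:
  fixes M :: "('a::{t2_space, second_countable_topology}, 'e::euclidean_space) manifold"
    and M' :: "('c::{t2_space, second_countable_topology}, 'k::euclidean_space) manifold"
  assumes t: "fibre_translation M Q a p S \<tau>" and t': "fibre_translation M' Q' a' (\<Phi> p) S' \<tau>'"
    and \<Phi>: "smooth_map_on M UNIV M' \<Phi>" and S': "\<And>x. x \<in> S \<Longrightarrow> \<Phi> x \<in> S'"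
    and eq: "\<And>x. x \<in> S \<Longrightarrow> \<Phi> (\<tau> x) = \<tau>' (\<Phi> x)"
    and v: "v \<in> fibre_translation.kern M Q a p"
  shows "tangent_map M' \<Phi> (\<tau> p) (fibre_translation.translate M p S \<tau> v)
    = fibre_translation.translate M' (\<Phi> p) S' \<tau>' (tangent_map M' \<Phi> p v)"
proof -
  interpret t: fibre_translation M Q a p S \<tau> by (rule t)
  interpret t': fibre_translation M' Q' a' "\<Phi> p" S' \<tau>' by (rule t')
  let ?w = "pull_incl M S p v"
  note p = t.p_in_fibre
  note w = t.pull_incl_kern[OF v]
  have near: "smooth_map_near M M' \<Phi> x" for x
    using \<Phi> smooth_map_at_UNIV_iff[OF t.M, of M' \<Phi> x] unfolding smooth_map_on_def by blast
  let ?w' = "tangent_map_on M' S' \<Phi> p ?w"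
  have w': "?w' \<in> tangent_space M' S' (\<Phi> p)"
    by (rule tangent_map_on_in_tangent_space[OF t.M t'.M p w(1) smooth_map_near_imp_at[OF near] S'])
  have "push_incl M' (\<Phi> p) ?w' = tangent_map M' \<Phi> p v"
    using push_incl_tangent_map_on[OF t.M t'.M p near w(1) S'] w(2) by simp
  then have pull: "pull_incl M' S' (\<Phi> p) (tangent_map M' \<Phi> p v) = ?w'"
    using pull_incl_push_incl[OF t'.M t'.p_in_fibre w'] by simp
  have "tangent_map M' \<Phi> (\<tau> p) (tangent_map M \<tau> p ?w) \<phi> = tangent_map M' \<tau>' (\<Phi> p) ?w' \<phi>" for \<phi>
  proof (cases "\<phi> \<in> smooth_funs_at M' UNIV (\<Phi> (\<tau> p))")
    case True
    then have True': "\<phi> \<in> smooth_funs_at M' UNIV (\<tau>' (\<Phi> p))" using eq[OF p] by simp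
    have 1: "\<phi> \<circ> \<Phi> \<in> smooth_funs_at M UNIV (\<tau> p)"
      using smooth_funs_at_compose[OF t.M t'.M UNIV_I smooth_map_near_imp_at[OF near] True] by simp
    have 2: "\<phi> \<circ> \<tau>' \<in> smooth_funs_at M' S' (\<Phi> p)"
      using smooth_funs_at_compose[OF t'.M t'.M t'.p_in_fibre t'.\<tau> True'] by simp
    have 3: "\<phi> \<circ> \<tau>' \<circ> \<Phi> \<in> smooth_funs_at M S p"
      by (rule smooth_funs_at_compose[OF t.M t'.M p smooth_map_near_imp_at[OF near] 2 S'])
    have "?w (\<phi> \<circ> \<tau>' \<circ> \<Phi>) = ?w (\<phi> \<circ> \<Phi> \<circ> \<tau>)"
      by (rule tangent_space_local[OF t.M w(1) p 3 open_UNIV UNIV_I]) (simp add: eq)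
    then show ?thesis
      using True True' 1 2 by (simp add: tangent_map_def tangent_map_on_def comp_assoc)
  next
    case False
    then show ?thesis using eq[OF p] by (simp add: tangent_map_def)
  qed
  then show ?thesis by (simp add: t.translate_def t'.translate_def pull fun_eq_iff)
qed

section \<open>Lie groupoids and their morphisms\<close>

context
  fixes G :: "('g, 'q, 'e, 'f) groupoid"
  assumes laws: "groupoid_laws G"
begin

lemma mult_assoc: "tgt G g = src G h \<Longrightarrow> tgt G h = src G k \<Longrightarrow>
    mult G (mult G g h) k = mult G g (mult G h k)"
  and src_ident: "src G (ident G q) = q" and tgt_ident: "tgt G (ident G q) = q"
  and ident_mult: "mult G (ident G (src G g)) g = g" and mult_ident: "mult G g (ident G (tgt G g)) = g"
  and src_ginv: "src G (ginv G g) = tgt G g" and tgt_ginv: "tgt G (ginv G g) = src G g"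
  and mult_ginv: "mult G g (ginv G g) = ident G (src G g)"
  and ginv_mult: "mult G (ginv G g) g = ident G (tgt G g)"
  using laws by (auto simp: groupoid_laws_def composable_def)

lemma idempotent_imp_ident:
  assumes "tgt G x = src G x" "mult G x x = x"
  shows "x = ident G (src G x)"
proof -
  have "mult G (mult G (ginv G x) x) x = mult G (ginv G x) (mult G x x)"
    by (rule mult_assoc) (simp_all add: tgt_ginv assms(1))
  then show ?thesis using ident_mult[of x] by (simp add: ginv_mult assms)
qed

lemma left_inverse_unique:
  assumes "tgt G y = src G x" "mult G y x = ident G (tgt G x)"
  shows "y = ginv G x"
proof -
  have "mult G (mult G y x) (ginv G x) = mult G y (mult G x (ginv G x))"
    by (rule mult_assoc) (simp_all add: src_ginv assms(1))
  then show ?thesis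
    using ident_mult[of "ginv G x"] mult_ident[of y] by (simp add: assms mult_ginv src_ginv)
qed

lemma ginv_ident: "ginv G (ident G q) = ident G q"
  by (rule left_inverse_unique[symmetric])
     (use ident_mult[of "ident G q"] in \<open>simp_all add: src_ident tgt_ident\<close>)

end

lemma morphism_composable:
  assumes "lie_groupoid_morphism G G' \<Phi>" "tgt G g = src G h"
  shows "tgt G' (\<Phi> g) = src G' (\<Phi> h)" "\<Phi> (mult G g h) = mult G' (\<Phi> g) (\<Phi> h)"
  using assms by (auto simp: lie_groupoid_morphism_def composable_def)

text \<open>Preservation of products makes the image of an identity idempotent, and idempotents of a groupoid are
  identities.\<close>

lemma morphism_ident:
  assumes G: "groupoid_laws G" and G': "groupoid_laws G'" and \<Phi>: "lie_groupoid_morphism G G' \<Phi>"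
  shows "\<Phi> (ident G q) = ident G' (base_map G G' \<Phi> q)"
proof -
  let ?e = "ident G q"
  have "tgt G ?e = src G ?e" "mult G ?e ?e = ?e"
    using ident_mult[OF G, of ?e] by (simp_all add: src_ident[OF G] tgt_ident[OF G])
  then have "tgt G' (\<Phi> ?e) = src G' (\<Phi> ?e)" "mult G' (\<Phi> ?e) (\<Phi> ?e) = \<Phi> ?e"
    using morphism_composable[OF \<Phi>, of ?e ?e] by simp_all
  then show ?thesis unfolding base_map_def by (rule idempotent_imp_ident[OF G'])
qed

lemma morphism_src_tgt:
  assumes G: "groupoid_laws G" and G': "groupoid_laws G'" and \<Phi>: "lie_groupoid_morphism G G' \<Phi>"
  shows "src G' (\<Phi> g) = base_map G G' \<Phi> (src G g)" "tgt G' (\<Phi> g) = base_map G G' \<Phi> (tgt G g)"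
  using morphism_composable(1)[OF \<Phi>, of "ident G (src G g)" g] morphism_composable(1)[OF \<Phi>, of g "ident G (tgt G g)"]
  by (simp_all add: src_ident[OF G] tgt_ident[OF G] morphism_ident[OF assms] src_ident[OF G'] tgt_ident[OF G'])

lemma morphism_ginv:
  assumes G: "groupoid_laws G" and G': "groupoid_laws G'" and \<Phi>: "lie_groupoid_morphism G G' \<Phi>"
  shows "\<Phi> (ginv G g) = ginv G' (\<Phi> g)"
proof (rule left_inverse_unique[OF G'])
  have c: "tgt G (ginv G g) = src G g" by (rule tgt_ginv[OF G])
  show "tgt G' (\<Phi> (ginv G g)) = src G' (\<Phi> g)" by (rule morphism_composable(1)[OF \<Phi> c])
  show "mult G' (\<Phi> (ginv G g)) (\<Phi> g) = ident G' (tgt G' (\<Phi> g))"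
    using morphism_composable(2)[OF \<Phi> c]
    by (simp add: ginv_mult[OF G] morphism_ident[OF assms] morphism_src_tgt[OF assms])
qed

lemma left_translation:
  fixes G :: "('g::{t2_space, second_countable_topology}, 'q::{t2_space, second_countable_topology},
      'e::euclidean_space, 'f::euclidean_space) groupoid"
  assumes G: "lie_groupoid G"
  shows "fibre_translation (arrows G) (objects G) (src G) (ident G (tgt G g)) {h. src G h = tgt G g}
    (\<lambda>h. mult G g h)"
proof -
  note M = G[unfolded lie_groupoid_def]
  have l: "groupoid_laws G" using M by simp
  let ?p = "ident G (tgt G g)" and ?S = "{h. src G h = tgt G g}"
  have "smooth_map_at (arrows G) ?S (arrows G) (\<lambda>h. (\<lambda>(g, h). mult G g h) (g, h)) ?p"
  proof (rule smooth_map_at_compose_pair[where f = "\<lambda>h. g" and g = "\<lambda>h. h" and T = "composable G"])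
    have "(g, ?p) \<in> composable G" by (simp add: composable_def src_ident[OF l])
    then show "smooth_map_at (prod_manifold (arrows G) (arrows G)) (composable G) (arrows G)
        (\<lambda>(g, h). mult G g h) (g, ?p)"
      using M by (simp add: smooth_map_on_def)
  qed (use M in \<open>auto simp: src_ident[OF l] composable_def
        intro!: smooth_map_near_imp_at smooth_map_near_const smooth_map_near_id\<close>)
  then show ?thesis
    using M by (simp add: fibre_translation_def src_ident[OF l])
qed

lemma right_translation:
  fixes G :: "('g::{t2_space, second_countable_topology}, 'q::{t2_space, second_countable_topology},
      'e::euclidean_space, 'f::euclidean_space) groupoid"
  assumes G: "lie_groupoid G"
  shows "fibre_translation (arrows G) (objects G) (src G) (ident G (src G g)) {h. src G h = src G g}
    (\<lambda>h. mult G (ginv G h) g)"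
proof -
  note M = G[unfolded lie_groupoid_def]
  have l: "groupoid_laws G" using M by simp
  let ?p = "ident G (src G g)" and ?S = "{h. src G h = src G g}"
  have "smooth_map_at (arrows G) ?S (arrows G) (\<lambda>h. (\<lambda>(g, h). mult G g h) (ginv G h, g)) ?p"
  proof (rule smooth_map_at_compose_pair[where f = "ginv G" and g = "\<lambda>h. g" and T = "composable G"])
    have "(ginv G ?p, g) \<in> composable G"
      by (simp add: composable_def ginv_ident[OF l] tgt_ident[OF l])
    then show "smooth_map_at (prod_manifold (arrows G) (arrows G)) (composable G) (arrows G)
        (\<lambda>(g, h). mult G g h) (ginv G ?p, g)"
      using M by (simp add: smooth_map_on_def)
    show "smooth_map_at (arrows G) ?S (arrows G) (ginv G) ?p"
      using M smooth_map_at_subset[of "arrows G" UNIV "arrows G" "ginv G" ?p ?S] by (simp add: smooth_map_on_def)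
  qed (use M in \<open>auto simp: src_ident[OF l] tgt_ginv[OF l] composable_def
        intro!: smooth_map_near_imp_at smooth_map_near_const\<close>)
  then show ?thesis
    using M by (simp add: fibre_translation_def src_ident[OF l])
qed

lemma algebroid_eq_kern:
  "fibre_translation (arrows G) (objects G) (src G) (ident G q) S \<tau> \<Longrightarrow>
    fibre_translation.kern (arrows G) (objects G) (src G) (ident G q) = algebroid G q"
  by (simp add: fibre_translation.kern_def algebroid_def)

text \<open>The relation \<open>\<alpha>' \<circ> \<Phi> = \<Phi>\<^sub>0 \<circ> \<alpha>\<close> carries the kernel of \<open>T\<alpha>\<close> to the kernel of \<open>T\<alpha>'\<close>.  The
  vector \<open>T\<alpha>(v)\<close> is applied to functions \<open>\<phi> \<circ> \<Phi>\<^sub>0\<close>, which are smooth since \<open>\<Phi>\<^sub>0 = \<alpha>' \<circ> \<Phi> \<circ> \<epsilon>\<close>.\<close>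

lemma algebroid_map_in_algebroid:
  fixes G :: "('g::{t2_space, second_countable_topology}, 'q::{t2_space, second_countable_topology},
                'e::euclidean_space, 'f::euclidean_space) groupoid"
    and G' :: "('h::{t2_space, second_countable_topology}, 'r::{t2_space, second_countable_topology},
                'k::euclidean_space, 'l::euclidean_space) groupoid"
  assumes G: "lie_groupoid G" and G': "lie_groupoid G'" and \<Phi>: "lie_groupoid_morphism G G' \<Phi>"
    and v: "v \<in> algebroid G q"
  shows "algebroid_map G G' \<Phi> q v \<in> algebroid G' (base_map G G' \<Phi> q)"
proof -
  note M = G[unfolded lie_groupoid_def] and M' = G'[unfolded lie_groupoid_def]
  have l: "groupoid_laws G" and l': "groupoid_laws G'" using M M' by simp_all
  note m = M[THEN conjunct1] M[THEN conjunct2, THEN conjunct1] M'[THEN conjunct1] M'[THEN conjunct2, THEN conjunct1]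
  let ?e = "ident G q" and ?e' = "ident G' (base_map G G' \<Phi> q)"
  have e: "\<Phi> ?e = ?e'" by (rule morphism_ident[OF l l' \<Phi>])
  have \<Phi>s: "smooth_map_at (arrows G) UNIV (arrows G') \<Phi> x" for x
    using \<Phi> by (simp add: lie_groupoid_morphism_def smooth_map_on_def)
  have src's: "smooth_map_at (arrows G') UNIV (objects G') (src G') x" for x
    using M' by (simp add: submersion_def smooth_map_on_def)
  have srcs: "smooth_map_at (arrows G) UNIV (objects G) (src G) x" for x
    using M by (simp add: submersion_def smooth_map_on_def)
  have idents: "smooth_map_at (objects G) UNIV (arrows G) (ident G) q"
    using M by (simp add: smooth_map_on_def)
  have "smooth_map_at (objects G) UNIV (arrows G') (\<lambda>q. \<Phi> (ident G q)) q"
    by (rule smooth_map_at_compose[where f = "ident G" and g = \<Phi>, OF m(2,1) UNIV_I idents \<Phi>s UNIV_I])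
  then have base: "smooth_map_at (objects G) UNIV (objects G') (base_map G G' \<Phi>) q"
    unfolding base_map_def
    by (rule smooth_map_at_compose[where f = "\<lambda>q. \<Phi> (ident G q)" and g = "src G'",
          OF m(2,3) UNIV_I _ src's UNIV_I])
  have vT: "v \<in> tangent_space (arrows G) UNIV ?e"
    and ker: "tangent_map (objects G) (src G) ?e v \<psi> = 0" for \<psi>
    using v by (simp_all add: algebroid_def)
  let ?w = "tangent_map (arrows G') \<Phi> ?e v"
  have "?w \<in> tangent_space (arrows G') UNIV (\<Phi> ?e)"
    unfolding tangent_map_on_UNIV[symmetric]
    by (rule tangent_map_on_in_tangent_space[OF m(1,3) UNIV_I vT \<Phi>s UNIV_I])
  moreover have "tangent_map (objects G') (src G') ?e' ?w \<phi> = 0" for \<phi>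
  proof (cases "\<phi> \<in> smooth_funs_at (objects G') UNIV (src G' ?e')")
    case True
    have "\<phi> \<circ> src G' \<in> smooth_funs_at (arrows G') UNIV ?e'"
      by (rule smooth_funs_at_compose[OF m(3,4) UNIV_I src's True UNIV_I])
    then have "tangent_map (objects G') (src G') ?e' ?w \<phi> = v (\<phi> \<circ> src G' \<circ> \<Phi>)"
      using True by (simp add: tangent_map_def e)
    also have "\<phi> \<circ> src G' \<circ> \<Phi> = (\<phi> \<circ> base_map G G' \<Phi>) \<circ> src G"
      by (simp add: fun_eq_iff morphism_src_tgt(1)[OF l l' \<Phi>])
    also have "v \<dots> = tangent_map (objects G) (src G) ?e v (\<phi> \<circ> base_map G G' \<Phi>)"
    proof -
      have "\<phi> \<in> smooth_funs_at (objects G') UNIV (base_map G G' \<Phi> q)"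
        using True by (simp add: src_ident[OF l'])
      then have "\<phi> \<circ> base_map G G' \<Phi> \<in> smooth_funs_at (objects G) UNIV q"
        by (rule smooth_funs_at_compose[OF m(2,4) UNIV_I base _ UNIV_I])
      then show ?thesis by (simp add: tangent_map_def src_ident[OF l])
    qed
    also have "\<dots> = 0" by (rule ker)
    finally show ?thesis .
  qed (simp add: tangent_map_def)
  ultimately show ?thesis by (simp add: algebroid_def algebroid_map_def e fun_eq_iff)
qed

section \<open>Related covectors\<close>

lemma tangent_map_scale: "tangent_map M' f p (\<lambda>\<phi>. k * v \<phi>) = (\<lambda>\<phi>. k * tangent_map M' f p v \<phi>)"
  by (auto simp: tangent_map_def)

text \<open>The common form of the claims on sources and targets: pairing a covector at \<open>g\<close> with translates of vectors of
  the Lie algebroid.  The relation between \<open>\<mu>\<close> and \<open>\<mu>'\<close> is transported by naturality of translations.\<close>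

lemma dual_algebroid_related_translate:
  fixes G :: "('g::{t2_space, second_countable_topology}, 'q::{t2_space, second_countable_topology},
                'e::euclidean_space, 'f::euclidean_space) groupoid"
    and G' :: "('h::{t2_space, second_countable_topology}, 'r::{t2_space, second_countable_topology},
                'k::euclidean_space, 'l::euclidean_space) groupoid"
  assumes G: "lie_groupoid G" and G': "lie_groupoid G'" and \<Phi>: "lie_groupoid_morphism G G' \<Phi>"
    and q': "q' = base_map G G' \<Phi> q"
    and t: "fibre_translation (arrows G) (objects G) (src G) (ident G q) S \<tau>"
    and t': "fibre_translation (arrows G') (objects G') (src G') (ident G' q') S' \<tau>'"
    and g: "\<tau> (ident G q) = g"
    and S': "\<And>h. h \<in> S \<Longrightarrow> \<Phi> h \<in> S'" and eq: "\<And>h. h \<in> S \<Longrightarrow> \<Phi> (\<tau> h) = \<tau>' (\<Phi> h)"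
    and rel: "cotangent_related (arrows G) (arrows G') \<Phi> (g, \<mu>) (\<Phi> g, \<mu>')"
  shows "dual_algebroid_related G G' \<Phi>
    (q, \<lambda>v. if v \<in> algebroid G q then \<mu> (\<lambda>\<phi>. k * fibre_translation.translate (arrows G) (ident G q) S \<tau> v \<phi>) else 0)
    (q', \<lambda>v. if v \<in> algebroid G' q' then \<mu>' (\<lambda>\<phi>. k * fibre_translation.translate (arrows G') (ident G' q') S' \<tau>' v \<phi>) else 0)"
proof -
  interpret t: fibre_translation "arrows G" "objects G" "src G" "ident G q" S \<tau> by (rule t)
  interpret t': fibre_translation "arrows G'" "objects G'" "src G'" "ident G' q'" S' \<tau>' by (rule t')
  have l: "groupoid_laws G" and l': "groupoid_laws G'"
    using G G' by (simp_all add: lie_groupoid_def)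
  have e: "\<Phi> (ident G q) = ident G' q'" unfolding q' by (rule morphism_ident[OF l l' \<Phi>])
  have g': "\<tau>' (ident G' q') = \<Phi> g" using eq[OF t.p_in_fibre] g e by simp
  have \<Phi>s: "smooth_map_on (arrows G) UNIV (arrows G') \<Phi>" using \<Phi> by (simp add: lie_groupoid_morphism_def)
  have \<mu>: "\<mu> \<in> dual_space (tangent_space (arrows G) UNIV (\<tau> (ident G q)))"
    and \<mu>': "\<mu>' \<in> dual_space (tangent_space (arrows G') UNIV (\<tau>' (ident G' q')))"
    and rel': "\<And>v. v \<in> tangent_space (arrows G) UNIV g \<Longrightarrow> \<mu> v = \<mu>' (tangent_map (arrows G') \<Phi> g v)"
    using rel by (auto simp: cotangent_related_def cotangent_bundle_def g g')
  have "\<mu> (\<lambda>\<phi>. k * t.translate v \<phi>) = \<mu>' (\<lambda>\<phi>. k * t'.translate (algebroid_map G G' \<Phi> q v) \<phi>)"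
    if v: "v \<in> algebroid G q" for v
  proof -
    have kern: "v \<in> t.kern" using v algebroid_eq_kern[OF t] by simp
    have "t.translate v \<in> tangent_space (arrows G) UNIV g" using t.translate_in_tangent_space[OF kern] g by simp
    then have "(\<lambda>\<phi>. k * t.translate v \<phi>) \<in> tangent_space (arrows G) UNIV g"
      using tangent_space_lincomb[OF t.M, of "t.translate v" UNIV g "t.translate v" k 0] by simp
    then have "\<mu> (\<lambda>\<phi>. k * t.translate v \<phi>) = \<mu>' (\<lambda>\<phi>. k * tangent_map (arrows G') \<Phi> g (t.translate v) \<phi>)"
      by (simp only: rel' tangent_map_scale)
    moreover have "tangent_map (arrows G') \<Phi> g (t.translate v) = t'.translate (algebroid_map G G' \<Phi> q v)"
      using translate_natural[OF t t'[folded e] \<Phi>s S' eq kern] by (simp add: g e algebroid_map_def)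
    ultimately show ?thesis by simp
  qed
  moreover have "algebroid_map G G' \<Phi> q v \<in> algebroid G' q'" if "v \<in> algebroid G q" for v
    using algebroid_map_in_algebroid[OF G G' \<Phi> that] q' by simp
  ultimately show ?thesis
    using t.translate_dual[OF \<mu>, of k, unfolded algebroid_eq_kern[OF t]]
      t'.translate_dual[OF \<mu>', of k, unfolded algebroid_eq_kern[OF t']]
    by (simp add: dual_algebroid_related_def dual_algebroid_def q'[symmetric])
qed

lemma cot_src_related:
  fixes G :: "('g::{t2_space, second_countable_topology}, 'q::{t2_space, second_countable_topology},
                'e::euclidean_space, 'f::euclidean_space) groupoid"
    and G' :: "('h::{t2_space, second_countable_topology}, 'r::{t2_space, second_countable_topology},
                'k::euclidean_space, 'l::euclidean_space) groupoid"
  assumes G: "lie_groupoid G" and G': "lie_groupoid G'" and \<Phi>: "lie_groupoid_morphism G G' \<Phi>"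
    and rel: "cotangent_related (arrows G) (arrows G') \<Phi> \<mu> \<mu>'"
  shows "dual_algebroid_related G G' \<Phi> (cot_src G \<mu>) (cot_src G' \<mu>')"
proof -
  obtain g m m' where \<mu>: "\<mu> = (g, m)" "\<mu>' = (\<Phi> g, m')"
    using rel by (cases \<mu>, cases \<mu>') (auto simp: cotangent_related_def)
  have l: "groupoid_laws G" and l': "groupoid_laws G'"
    using G G' by (simp_all add: lie_groupoid_def)
  note t = right_translation[OF G, of g] and t' = right_translation[OF G', of "\<Phi> g"]
  have "mult G (ginv G (ident G (src G g))) g = g"
    by (simp add: ginv_ident[OF l] ident_mult[OF l])
  moreover have "\<Phi> h \<in> {h. src G' h = src G' (\<Phi> g)}" if "h \<in> {h. src G h = src G g}" for h
    using that by (simp add: morphism_src_tgt(1)[OF l l' \<Phi>])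
  moreover have "\<Phi> (mult G (ginv G h) g) = mult G' (ginv G' (\<Phi> h)) (\<Phi> g)"
    if "h \<in> {h. src G h = src G g}" for h
    using morphism_composable(2)[OF \<Phi>, of "ginv G h" g] that
    by (simp add: tgt_ginv[OF l] morphism_ginv[OF l l' \<Phi>])
  ultimately have "dual_algebroid_related G G' \<Phi>
    (src G g, \<lambda>v. if v \<in> algebroid G (src G g) then m (\<lambda>\<phi>. - 1 * right_translate_inv G g v \<phi>) else 0)
    (src G' (\<Phi> g), \<lambda>v. if v \<in> algebroid G' (src G' (\<Phi> g)) then m' (\<lambda>\<phi>. - 1 * right_translate_inv G' (\<Phi> g) v \<phi>) else 0)"
    unfolding right_translate_inv_def fibre_translation.translate_def[OF t, symmetric]
      fibre_translation.translate_def[OF t', symmetric]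
    by (rule dual_algebroid_related_translate[OF G G' \<Phi> morphism_src_tgt(1)[OF l l' \<Phi>] t t' _ _ _ rel[unfolded \<mu>]])
  then show ?thesis unfolding mult_minus1 by (simp add: \<mu> cot_src_def)
qed

lemma cot_tgt_related:
  fixes G :: "('g::{t2_space, second_countable_topology}, 'q::{t2_space, second_countable_topology},
                'e::euclidean_space, 'f::euclidean_space) groupoid"
    and G' :: "('h::{t2_space, second_countable_topology}, 'r::{t2_space, second_countable_topology},
                'k::euclidean_space, 'l::euclidean_space) groupoid"
  assumes G: "lie_groupoid G" and G': "lie_groupoid G'" and \<Phi>: "lie_groupoid_morphism G G' \<Phi>"
    and rel: "cotangent_related (arrows G) (arrows G') \<Phi> \<mu> \<mu>'"
  shows "dual_algebroid_related G G' \<Phi> (cot_tgt G \<mu>) (cot_tgt G' \<mu>')"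
proof -
  obtain g m m' where \<mu>: "\<mu> = (g, m)" "\<mu>' = (\<Phi> g, m')"
    using rel by (cases \<mu>, cases \<mu>') (auto simp: cotangent_related_def)
  have l: "groupoid_laws G" and l': "groupoid_laws G'"
    using G G' by (simp_all add: lie_groupoid_def)
  note t = left_translation[OF G, of g] and t' = left_translation[OF G', of "\<Phi> g"]
  have "mult G g (ident G (tgt G g)) = g" by (rule mult_ident[OF l])
  moreover have "\<Phi> h \<in> {h. src G' h = tgt G' (\<Phi> g)}" if "h \<in> {h. src G h = tgt G g}" for h
    using that by (simp add: morphism_src_tgt[OF l l' \<Phi>])
  moreover have "\<Phi> (mult G g h) = mult G' (\<Phi> g) (\<Phi> h)" if "h \<in> {h. src G h = tgt G g}" for h
    using morphism_composable(2)[OF \<Phi>, of g h] that by simp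
  ultimately have "dual_algebroid_related G G' \<Phi>
    (tgt G g, \<lambda>v. if v \<in> algebroid G (tgt G g) then m (\<lambda>\<phi>. 1 * left_translate G g v \<phi>) else 0)
    (tgt G' (\<Phi> g), \<lambda>v. if v \<in> algebroid G' (tgt G' (\<Phi> g)) then m' (\<lambda>\<phi>. 1 * left_translate G' (\<Phi> g) v \<phi>) else 0)"
    unfolding left_translate_def fibre_translation.translate_def[OF t, symmetric]
      fibre_translation.translate_def[OF t', symmetric]
    by (rule dual_algebroid_related_translate[OF G G' \<Phi> morphism_src_tgt(2)[OF l l' \<Phi>] t t' _ _ _ rel[unfolded \<mu>]])
  then show ?thesis unfolding mult_1 by (simp add: \<mu> cot_tgt_def)
qed

text \<open>For \<open>v\<close> tangent to \<open>N\<close> the vector \<open>T\<Phi>(v)\<close> is tangent to \<open>N'\<close>, and both sides evaluate to the derivative of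
  \<open>L' \<circ> \<Phi>\<close>, which equals \<open>L\<close> on \<open>N\<close>.\<close>

lemma lagrangian_submanifold_related:
  fixes G :: "('g::{t2_space, second_countable_topology}, 'q::{t2_space, second_countable_topology},
                'e::euclidean_space, 'f::euclidean_space) groupoid"
    and G' :: "('h::{t2_space, second_countable_topology}, 'r::{t2_space, second_countable_topology},
                'k::euclidean_space, 'l::euclidean_space) groupoid"
  assumes G: "lie_groupoid G" and G': "discrete_constrained_lagrangian_system G' N' L'"
    and \<Phi>: "dcls_morphism G N L G' N' L' \<Phi>"
    and rel: "cotangent_related (arrows G) (arrows G') \<Phi> \<mu> \<mu>'"
    and \<mu>': "\<mu>' \<in> lagrangian_submanifold G' N' L'"
  shows "\<mu> \<in> lagrangian_submanifold G N L"
proof -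
  have m: "smooth_manifold (arrows G)" "smooth_manifold (arrows G')"
    using G G' by (simp_all add: lie_groupoid_def discrete_constrained_lagrangian_system_def)
  have N: "N = \<Phi> -` N'" and L: "\<And>h. h \<in> N \<Longrightarrow> L h = L' (\<Phi> h)"
    using \<Phi> by (simp_all add: dcls_morphism_def)
  have near: "smooth_map_near (arrows G) (arrows G') \<Phi> x" for x
    using \<Phi> smooth_map_at_UNIV_iff[OF m(1), of "arrows G'" \<Phi> x]
    unfolding dcls_morphism_def lie_groupoid_morphism_def smooth_map_on_def by blast
  obtain g p p' where \<mu>: "\<mu> = (g, p)" "\<mu>' = (\<Phi> g, p')"
    using rel by (cases \<mu>, cases \<mu>') (auto simp: cotangent_related_def)
  have g: "g \<in> N" "\<Phi> g \<in> N'" using \<mu>' N by (auto simp: \<mu> lagrangian_submanifold_def)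
  have N': "\<Phi> h \<in> N'" if "h \<in> N" for h using that N by simp
  have "p (push_incl (arrows G) g v) = differential L v" if v: "v \<in> tangent_space (arrows G) N g" for v
  proof -
    let ?w = "tangent_map_on (arrows G') N' \<Phi> g v"
    have w: "?w \<in> tangent_space (arrows G') N' (\<Phi> g)"
      by (rule tangent_map_on_in_tangent_space[OF m g(1) v smooth_map_near_imp_at[OF near] N'])
    have L's: "L' \<in> smooth_funs_at (arrows G') N' (\<Phi> g)"
      using G' g(2) by (simp add: discrete_constrained_lagrangian_system_def smooth_map_on_def smooth_funs_at_def)
    have "p (push_incl (arrows G) g v) = p' (tangent_map (arrows G') \<Phi> g (push_incl (arrows G) g v))"
      using rel push_incl_in_tangent_space[OF m(1) g(1) v] by (simp add: \<mu> cotangent_related_def)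
    also have "\<dots> = p' (push_incl (arrows G') (\<Phi> g) ?w)"
      using push_incl_tangent_map_on[OF m g(1) near v N'] by simp
    also have "\<dots> = ?w L'"
      using \<mu>' w by (simp add: \<mu> lagrangian_submanifold_def differential_def)
    also have "\<dots> = v (L' \<circ> \<Phi>)" using L's by (simp add: tangent_map_on_def)
    also have "\<dots> = v L"
    proof (rule tangent_space_local[OF m(1) v g(1) _ open_UNIV UNIV_I])
      show "L' \<circ> \<Phi> \<in> smooth_funs_at (arrows G) N g"
        by (rule smooth_funs_at_compose[OF m g(1) smooth_map_near_imp_at[OF near] L's N'])
    qed (simp add: L)
    finally show ?thesis by (simp add: differential_def)
  qed
  then show ?thesis using rel g by (simp add: \<mu> lagrangian_submanifold_def cotangent_related_def)
qed

theorem theorem4p5: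
  fixes G :: "('g::{t2_space, second_countable_topology}, 'q::{t2_space, second_countable_topology},
                'e::euclidean_space, 'f::euclidean_space) groupoid"
    and G' :: "('h::{t2_space, second_countable_topology}, 'r::{t2_space, second_countable_topology},
                'k::euclidean_space, 'l::euclidean_space) groupoid"
    and N :: "'g set" and L :: "'g \<Rightarrow> real"
    and N' :: "'h set" and L' :: "'h \<Rightarrow> real"
    and \<Phi> :: "'g \<Rightarrow> 'h"
    and \<mu> :: "'g \<times> ('g tangent_vector \<Rightarrow> real)"
    and \<mu>' :: "'h \<times> ('h tangent_vector \<Rightarrow> real)"
  assumes "discrete_constrained_lagrangian_system G N L"
    and "discrete_constrained_lagrangian_system G' N' L'"
    and "dcls_morphism G N L G' N' L' \<Phi>"
    and "\<mu> \<in> cotangent_bundle (arrows G)"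
    and "\<mu>' \<in> cotangent_bundle (arrows G')"
    and "cotangent_related (arrows G) (arrows G') \<Phi> \<mu> \<mu>'"
  shows "(\<mu>' \<in> lagrangian_submanifold G' N' L' \<longrightarrow> \<mu> \<in> lagrangian_submanifold G N L) \<and>
         dual_algebroid_related G G' \<Phi> (cot_src G \<mu>) (cot_src G' \<mu>') \<and>
         dual_algebroid_related G G' \<Phi> (cot_tgt G \<mu>) (cot_tgt G' \<mu>')"
proof -
  have G: "lie_groupoid G" "lie_groupoid G'"
    using assms(1,2) by (simp_all add: discrete_constrained_lagrangian_system_def)
  have \<Phi>: "lie_groupoid_morphism G G' \<Phi>" using assms(3) by (simp add: dcls_morphism_def)
  show ?thesis
    using lagrangian_submanifold_related[OF G(1) assms(2,3,6)] cot_src_related[OF G \<Phi> assms(6)]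
      cot_tgt_related[OF G \<Phi> assms(6)] by blast
qed

end
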